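(* Let $d\ge 1$ and let $F,G$ be distribution functions on $[0,\infty)$ such that $F$ strictly dominates $G$. If $d=1$, assume that $\int_0^\infty t\,dF(t)<\infty$ and $\int_0^\infty t\,dG(t)<\infty$. Then there exists a constant $0<c<\infty$ (which may depend on $d$, $F$ and $G$) such that for all $x\in\mathbb{R}^d\setminus\{0\}$, $$\alpha_F(x)-\alpha_G(x)\ge c\,\|x\|_1 .$$
   Context: $F$ strictly dominates $G$ means: $F(t)\le G(t)$ for all $t\geq 0$, but $F\not\equiv G$. Let $(S_k)_{k\ge0}$ be the simple random walk on $\mathbb{Z}^d$, with law $P^x$ and expectation $E^x$ when started at $x$. For a distribution function $\phi$ on $[0,\infty)$ let the potential $\omega=(\omega(x))_{x\in\mathbb{Z}^d}$ be i.i.d. with distribution function $\phi$, independent of the walk, with law $\mathbb{P}$. Let $H(y):=\inf\{k\ge0:S_k=y\}$ and $$e(x,y,\omega):=E^x\Bigl[\exp\Bigl\{-\sum_{k=0}^{H(y)-1}\omega(S_k)\Bigr\}\mathbf{1}_{\{H(y)<\infty\}}\Bigr]$$ ($e(x,x,\omega):=1$), and $a(x,y,\omega):=-\log e(x,y,\omega)$. It is known (assuming, when $d=1$, that $\phi$ has finite mean) that there is a unique norm (a seminorm, namely $0$, if $\omega\equiv0$) $\alpha_\phi(\cdot)$ on $\mathbb{R}^d$, called the quenched Lyapunov exponent, such that for all $x\in\mathbb{Z}^d$, $\lim_{n\to\infty}\frac1n a(0,nx,\omega)=\alpha_\phi(x)$ in probability. $\|\cdot\|_1$ is the $\ell^1$-norm.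 *)

theory Defs
  imports "HOL-Probability.Probability"
begin

definition distribution_function :: "(real \<Rightarrow> real) \<Rightarrow> bool" where
  "distribution_function \<phi> \<longleftrightarrow>
     mono \<phi> \<and> (\<forall>t. continuous (at_right t) \<phi>) \<and>
     (\<forall>t<0. \<phi> t = 0) \<and> (\<phi> \<longlongrightarrow> 1) at_top"

definition strictly_dominates :: "(real \<Rightarrow> real) \<Rightarrow> (real \<Rightarrow> real) \<Rightarrow> bool" where
  "strictly_dominates F G \<longleftrightarrow> (\<forall>t\<ge>0. F t \<le> G t) \<and> (\<exists>t\<ge>0. F t \<noteq> G t)"

text \<open>
  The lattice $\mathbb{Z}^d$ is the type \<^typ>\<open>int ^ 'd\<close>. The walk is realised on the space of
  sequences of i.i.d. increments, so the law of the increments does not depend on the starting point.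
\<close>

definition srw_step :: "(int ^ 'd::finite) pmf" where
  "srw_step = pmf_of_set (range (\<lambda>i. axis i 1) \<union> range (\<lambda>i. axis i (- 1)))"

definition srw_increments :: "(nat \<Rightarrow> int ^ 'd::finite) measure" where
  "srw_increments = (\<Pi>\<^sub>M k\<in>UNIV. measure_pmf srw_step)"

definition walk :: "int ^ 'd::finite \<Rightarrow> (nat \<Rightarrow> int ^ 'd) \<Rightarrow> nat \<Rightarrow> int ^ 'd" where
  "walk x \<xi> k = x + (\<Sum>j<k. \<xi> j)"

definition hitting_time :: "'a \<Rightarrow> (nat \<Rightarrow> 'a) \<Rightarrow> enat" where
  "hitting_time y S = (INF k\<in>{k. S k = y}. enat k)"

text \<open>
  If the hitting time is infinite, the sum below ranges over an infinite set and is \<^term>\<open>0\<close> by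
  convention; the indicator then makes the whole integrand vanish. For \<^term>\<open>x = y\<close> the sum is
  empty and the expectation equals \<^term>\<open>1\<close>.
\<close>

definition travel_weight ::
  "int ^ 'd::finite \<Rightarrow> int ^ 'd \<Rightarrow> (int ^ 'd \<Rightarrow> real) \<Rightarrow> real" where
  "travel_weight x y \<omega> =
     (\<integral>\<xi>. exp (- (\<Sum>k | enat k < hitting_time y (walk x \<xi>). \<omega> (walk x \<xi> k))) *
           indicator {\<xi>. hitting_time y (walk x \<xi>) < \<infinity>} \<xi> \<partial>srw_increments)"

definition travel_cost ::
  "int ^ 'd::finite \<Rightarrow> int ^ 'd \<Rightarrow> (int ^ 'd \<Rightarrow> real) \<Rightarrow> real" where
  "travel_cost x y \<omega> = - ln (travel_weight x y \<omega>)"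

definition potential_law :: "(real \<Rightarrow> real) \<Rightarrow> (int ^ 'd::finite \<Rightarrow> real) measure" where
  "potential_law \<phi> = (\<Pi>\<^sub>M x\<in>UNIV. interval_measure \<phi>)"

definition tendsto_in_prob :: "'a measure \<Rightarrow> (nat \<Rightarrow> 'a \<Rightarrow> real) \<Rightarrow> real \<Rightarrow> bool" where
  "tendsto_in_prob M X l \<longleftrightarrow>
     (\<forall>n. X n \<in> borel_measurable M) \<and>
     (\<forall>\<epsilon>>0. (\<lambda>n. \<P>(\<omega> in M. \<epsilon> < \<bar>X n \<omega> - l\<bar>)) \<longlonglongrightarrow> 0)"

definition seminorm :: "('a::real_vector \<Rightarrow> real) \<Rightarrow> bool" where
  "seminorm p \<longleftrightarrow> (\<forall>x y. p (x + y) \<le> p x + p y) \<and> (\<forall>c x. p (c *\<^sub>R x) = \<bar>c\<bar> * p x)"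

text \<open>
  The quenched Lyapunov exponent of \<^term>\<open>\<phi>\<close> is the (unique) seminorm \<^term>\<open>\<alpha>\<close> on
  $\mathbb{R}^d$ with this property. Asking only for a seminorm covers the potential that vanishes
  identically, where the exponent is \<^term>\<open>0\<close>; in all other cases the exponent is a norm.
\<close>

definition quenched_lyapunov_exponent ::
  "(real \<Rightarrow> real) \<Rightarrow> (real ^ 'd::finite \<Rightarrow> real) \<Rightarrow> bool" where
  "quenched_lyapunov_exponent \<phi> \<alpha> \<longleftrightarrow>
     seminorm \<alpha> \<and>
     (\<forall>x :: int ^ 'd.
        tendsto_in_prob (potential_law \<phi>)
          (\<lambda>n \<omega>. travel_cost 0 (int n *s x) \<omega> / real n)
          (\<alpha> (\<chi> i. real_of_int (x $ i))))"

definition l1_norm :: "real ^ 'd::finite \<Rightarrow> real" where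
  "l1_norm x = (\<Sum>i\<in>UNIV. \<bar>x $ i\<bar>)"

end

theory Submission
  imports Defs "HOL-Real_Asymp.Real_Asymp"
begin

text \<open>
  Both potentials are realised on one probability space: with i.i.d. uniform variables \<open>u z\<close>, the
  quantile functions give potentials \<open>\<omega>F z = quantile F (u z)\<close> and \<open>\<omega>G z = quantile G (u z)\<close> with the
  right laws. Domination yields \<open>\<omega>G \<le> \<omega>F\<close> everywhere, and strictness yields \<open>\<omega>G z + \<delta> \<le> \<omega>F z\<close> at each
  site with positive probability (\<open>quantile_gap\<close>). The task is to show that this increase is felt,
  that is, that the walk cannot avoid such sites at a negligible cost.

  Divide the lattice into boxes of side \<open>L\<close> and call a box good if it contains a site with the gap
  \<open>\<delta>\<close> and if \<open>\<omega>G\<close> is bounded by a constant on the box. The heart of the proof is the deterministic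
  comparison \<open>travel_weight_box_comparison\<close>: up to a constant factor, replacing \<open>\<omega>G\<close> by \<open>\<omega>F\<close> reduces
  the travel weight at least by a factor \<open>exp (- \<gamma>)\<close>, with a fixed \<open>\<gamma> > 0\<close>, for each good box that must be
  crossed on the way to the target. It holds because the walk weighted by \<open>\<omega>G\<close> has transition
  probabilities bounded below inside a good box, and hence a chance bounded below to hit the site
  with the gap. The proof turns this into an explicit
  supersolution of the first-step equation for \<open>\<omega>F\<close>, to which \<open>travel_weight_le_supersolution\<close> applies.

  It remains to see that every path to a distant target meets linearly many good boxes. A box is
  good with probability close to \<open>1\<close> if \<open>L\<close> and then the bound on \<open>\<omega>G\<close> are chosen large, and distinct
  boxes are independent. So a union bound over self-avoiding paths of boxes suffices
  (\<open>prob_not_good_paths\<close>); here it is essential to count paths of boxes rather than paths of sites,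
  as the number of paths must be beaten by the probability of a bad box.

  Dividing by the distance and passing to the limit in probability gives the bound in lattice
  directions (\<open>lattice_gap\<close>); homogeneity and subadditivity of the exponents extend it to all directions.
\<close>

section \<open>First-step analysis for the travel weight\<close>

definition steps :: "(int ^ 'd::finite) set" where
  "steps = range (\<lambda>i. axis i 1) \<union> range (\<lambda>i. axis i (- 1))"

lemma finite_steps: "finite (steps :: (int ^ 'd::finite) set)"
  by (simp add: steps_def)

lemma steps_nonempty: "steps \<noteq> ({} :: (int ^ 'd::finite) set)"
  by (simp add: steps_def)

lemma card_steps_pos: "real (card (steps :: (int ^ 'd::finite) set)) > 0"
  by (simp add: card_gt_0_iff finite_steps steps_nonempty)

lemma uminus_steps: "e \<in> steps \<Longrightarrow> - e \<in> steps"
  by (auto simp: steps_def axis_def vec_eq_iff image_iff)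

lemma expectation_srw_step:
  fixes f :: "int ^ 'd::finite \<Rightarrow> real"
  shows "(\<integral>e. f e \<partial>measure_pmf srw_step) = (\<Sum>e\<in>steps. f e) / card (steps :: (int ^ 'd) set)"
  unfolding srw_step_def steps_def[symmetric]
  by (rule integral_pmf_of_set[OF steps_nonempty finite_steps])

definition path_weight ::
  "int ^ 'd::finite \<Rightarrow> (int ^ 'd \<Rightarrow> real) \<Rightarrow> int ^ 'd \<Rightarrow> (nat \<Rightarrow> int ^ 'd) \<Rightarrow> real" where
  "path_weight y \<omega> x \<xi> =
     exp (- (\<Sum>k | enat k < hitting_time y (walk x \<xi>). \<omega> (walk x \<xi> k))) *
       indicator {\<xi>. hitting_time y (walk x \<xi>) < \<infinity>} \<xi>"

lemma less_hitting_time_iff: "enat k < hitting_time y S \<longleftrightarrow> (\<forall>j\<le>k. S j \<noteq> y)"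
proof (cases "\<exists>j. S j = y")
  case True
  define m where "m = (LEAST j. S j = y)"
  have "S m = y" "\<And>j. S j = y \<Longrightarrow> m \<le> j"
    unfolding m_def using True by (auto intro: LeastI_ex Least_le)
  then have "hitting_time y S = enat m"
    unfolding hitting_time_def by (intro antisym INF_lower INF_greatest) auto
  moreover have "k < m \<longleftrightarrow> (\<forall>j\<le>k. S j \<noteq> y)"
    using \<open>S m = y\<close> \<open>\<And>j. S j = y \<Longrightarrow> m \<le> j\<close> by (metis le_trans not_le)
  ultimately show ?thesis by simp
next
  case False
  then show ?thesis by (simp add: hitting_time_def top_enat_def)
qed

lemma hitting_time_finite_iff: "hitting_time y S < \<infinity> \<longleftrightarrow> (\<exists>k. S k = y)"
proof
  assume "hitting_time y S < \<infinity>"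
  then obtain n where "hitting_time y S = enat n" by auto
  then show "\<exists>k. S k = y"
    using less_hitting_time_iff[of n y S] by auto
next
  assume "\<exists>k. S k = y"
  then obtain k where "S k = y" ..
  then have "hitting_time y S \<le> enat k"
    unfolding hitting_time_def by (intro INF_lower) simp
  then show "hitting_time y S < \<infinity>"
    using enat_ord_code(4) le_less_trans by blast
qed

lemma path_weight_eq:
  "path_weight y \<omega> x \<xi> =
    (if \<exists>k. walk x \<xi> k = y then exp (- (\<Sum>k | \<forall>j\<le>k. walk x \<xi> j \<noteq> y. \<omega> (walk x \<xi> k))) else 0)"
  unfolding path_weight_def indicator_def mem_Collect_eq less_hitting_time_iff
    hitting_time_finite_iff by simp

lemma walk_0 [simp]: "walk x \<xi> 0 = x"
  by (simp add: walk_def)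

lemma walk_Suc: "walk x \<xi> (Suc k) = walk (x + \<xi> 0) (\<lambda>k. \<xi> (Suc k)) k"
  unfolding walk_def by (simp add: sum.lessThan_Suc_shift add.assoc del: sum.lessThan_Suc)

lemma path_weight_start: "path_weight y \<omega> y \<xi> = 1"
proof -
  have "{k. \<forall>j\<le>k. walk y \<xi> j \<noteq> y} = {}" "\<exists>k. walk y \<xi> k = y"
    by (auto intro: exI[of _ 0])
  then show ?thesis
    unfolding path_weight_eq by (simp only: sum.empty minus_zero exp_zero if_True)
qed

text \<open>
  The set of times before hitting \<open>y\<close> is finite exactly on the event that \<open>y\<close> is hit; outside this
  event both sides vanish, so the convention for sums over infinite sets does not interfere.
\<close>

lemma path_weight_step:
  assumes "x \<noteq> y"
  shows "path_weight y \<omega> x \<xi> = exp (- \<omega> x) * path_weight y \<omega> (x + \<xi> 0) (\<lambda>k. \<xi> (Suc k))"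
proof -
  define S where "S = walk x \<xi>"
  define S' where "S' = walk (x + \<xi> 0) (\<lambda>k. \<xi> (Suc k))"
  have S_Suc: "S (Suc k) = S' k" for k
    by (simp add: S_def S'_def walk_Suc)
  have S_0: "S 0 = x" by (simp add: S_def)
  have hit: "(\<exists>k. S k = y) \<longleftrightarrow> (\<exists>k. S' k = y)"
    using S_Suc S_0 assms by (metis not0_implies_Suc)
  show ?thesis
  proof (cases "\<exists>k. S' k = y")
    case False
    then show ?thesis
      using hit unfolding S_def S'_def by (simp add: path_weight_eq)
  next
    case True
    then obtain K where K: "S' K = y" ..
    define A where "A = {k. \<forall>j\<le>k. S j \<noteq> y}"
    define A' where "A' = {k. \<forall>j\<le>k. S' j \<noteq> y}"
    have "A' \<subseteq> {..<K}"
      using K by (auto simp: A'_def not_less[symmetric])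
    then have fin: "finite A'" by (rule finite_subset) simp
    have A: "A = insert 0 (Suc ` A')"
    proof (rule set_eqI)
      fix k show "k \<in> A \<longleftrightarrow> k \<in> insert 0 (Suc ` A')"
      proof (cases k)
        case 0
        then show ?thesis using assms S_0 by (simp add: A_def)
      next
        case (Suc k')
        have "(\<forall>j\<le>Suc k'. S j \<noteq> y) \<longleftrightarrow> S 0 \<noteq> y \<and> (\<forall>j\<le>k'. S (Suc j) \<noteq> y)"
          by (metis Suc_le_mono not0_implies_Suc zero_le)
        then show ?thesis
          using Suc assms S_0 by (auto simp: A_def A'_def S_Suc)
      qed
    qed
    have "(\<Sum>k\<in>A. \<omega> (S k)) = \<omega> x + (\<Sum>k\<in>A'. \<omega> (S' k))"
      using fin by (simp add: A S_0 sum.reindex S_Suc)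
    then have "exp (- (\<Sum>k\<in>A. \<omega> (S k))) = exp (- \<omega> x) * exp (- (\<Sum>k\<in>A'. \<omega> (S' k)))"
      by (simp add: exp_add[symmetric])
    then show ?thesis
      using True hit
      by (simp add: path_weight_eq S_def[symmetric] S'_def[symmetric] A_def[symmetric]
          A'_def[symmetric])
  qed
qed

lemma path_weight_nonneg: "0 \<le> path_weight y \<omega> x \<xi>"
  by (simp add: path_weight_def)

lemma path_weight_le_1:
  assumes "\<And>x. 0 \<le> \<omega> x"
  shows "path_weight y \<omega> x \<xi> \<le> 1"
  by (auto simp: path_weight_def indicator_def intro!: sum_nonneg assms)

text \<open>
  The contribution of the paths that reach \<open>y\<close> within \<open>n\<close> steps. The recursive form makes
  measurability and comparison with other functions accessible to induction on \<open>n\<close>.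
\<close>

fun truncated_weight ::
  "int ^ 'd::finite \<Rightarrow> (int ^ 'd \<Rightarrow> real) \<Rightarrow> nat \<Rightarrow> int ^ 'd \<Rightarrow> (nat \<Rightarrow> int ^ 'd) \<Rightarrow> real" where
  "truncated_weight y \<omega> 0 x \<xi> = of_bool (x = y)"
| "truncated_weight y \<omega> (Suc n) x \<xi> =
     (if x = y then 1 else exp (- \<omega> x) * truncated_weight y \<omega> n (x + \<xi> 0) (\<lambda>k. \<xi> (Suc k)))"

lemma truncated_weight_eq:
  "truncated_weight y \<omega> n x \<xi> = (if \<exists>k\<le>n. walk x \<xi> k = y then path_weight y \<omega> x \<xi> else 0)"
proof (induction n arbitrary: x \<xi>)
  case 0
  then show ?case by (auto simp: path_weight_start)
next
  case (Suc n)
  have "(\<exists>k\<le>Suc n. walk x \<xi> k = y) \<longleftrightarrow>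
      x = y \<or> (\<exists>k\<le>n. walk (x + \<xi> 0) (\<lambda>k. \<xi> (Suc k)) k = y)"
    by (metis Suc_le_mono not0_implies_Suc walk_0 walk_Suc zero_le)
  then show ?case
    using Suc.IH[of "x + \<xi> 0" "\<lambda>k. \<xi> (Suc k)"]
    by (auto simp: path_weight_start path_weight_step)
qed

lemma truncated_weight_tendsto:
  "(\<lambda>n. truncated_weight y \<omega> n x \<xi>) \<longlonglongrightarrow> path_weight y \<omega> x \<xi>"
proof (cases "\<exists>k. walk x \<xi> k = y")
  case True
  then obtain k where "walk x \<xi> k = y" ..
  then have "truncated_weight y \<omega> n x \<xi> = path_weight y \<omega> x \<xi>" if "n \<ge> k" for n
    using that by (auto simp: truncated_weight_eq)
  then show ?thesis
    by (intro tendsto_eventually) (auto simp: eventually_sequentially)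
next
  case False
  then show ?thesis
    by (auto simp: truncated_weight_eq path_weight_eq)
qed

lemma prob_space_srw_increments: "prob_space srw_increments"
  unfolding srw_increments_def by (intro prob_space_PiM measure_pmf.prob_space_axioms)

lemma measurable_after_first_step:
  fixes f :: "int ^ 'd::finite \<Rightarrow> (nat \<Rightarrow> int ^ 'd) \<Rightarrow> real"
  assumes "\<And>x. f x \<in> borel_measurable srw_increments"
  shows "(\<lambda>\<xi>. f (x + \<xi> 0) (\<lambda>k. \<xi> (Suc k))) \<in> borel_measurable srw_increments"
proof (rule measurable_compose_countable[where g = "\<lambda>\<xi>. \<xi> 0"
      and f = "\<lambda>e \<xi>. f (x + e) (\<lambda>k. \<xi> (Suc k))"])
  have "(\<lambda>\<xi> k. \<xi> (Suc k)) \<in> (srw_increments :: (nat \<Rightarrow> int ^ 'd) measure) \<rightarrow>\<^sub>M srw_increments"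
    unfolding srw_increments_def
    by (auto intro!: measurable_PiM_single' measurable_component_singleton simp: space_PiM)
  then show "(\<lambda>\<xi>. f (x + e) (\<lambda>k. \<xi> (Suc k))) \<in> borel_measurable srw_increments" for e
    by (rule measurable_compose[OF _ assms])
  show "(\<lambda>\<xi>. \<xi> 0) \<in> srw_increments \<rightarrow>\<^sub>M count_space UNIV"
    unfolding srw_increments_def
    by (rule measurable_compose[OF measurable_component_singleton[of 0]]) auto
qed

lemma truncated_weight_measurable [measurable]:
  "truncated_weight y \<omega> n x \<in> borel_measurable srw_increments"
proof (induction n arbitrary: x)
  case 0
  then show ?case by (simp add: truncated_weight.simps[abs_def])
next
  case (Suc n)
  show ?case
    using measurable_after_first_step[OF Suc.IH] by (cases "x = y") (simp_all add: fun_eq_iff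
      truncated_weight.simps(2)[abs_def])
qed

lemma path_weight_measurable [measurable]:
  "path_weight y \<omega> x \<in> borel_measurable srw_increments"
  by (rule borel_measurable_LIMSEQ_real[of _ "\<lambda>n. truncated_weight y \<omega> n x"])
     (auto simp: truncated_weight_tendsto)

text \<open>
  The increments after the first one again form an i.i.d. sequence, independent of the first
  one; so integrating out the first increment averages over the neighbours of the starting point.
\<close>

lemma integral_first_step:
  fixes f :: "int ^ 'd::finite \<Rightarrow> (nat \<Rightarrow> int ^ 'd) \<Rightarrow> real"
  assumes meas: "\<And>x. f x \<in> borel_measurable srw_increments"
    and bounds: "\<And>x \<xi>. 0 \<le> f x \<xi>" "\<And>x \<xi>. f x \<xi> \<le> 1"
  shows "(\<integral>\<xi>. f (x + \<xi> 0) (\<lambda>k. \<xi> (Suc k)) \<partial>srw_increments) =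
    (\<Sum>e\<in>steps. \<integral>\<xi>. f (x + e) \<xi> \<partial>srw_increments) / card (steps :: (int ^ 'd) set)"
proof -
  define p where "p = measure_pmf (srw_step :: (int ^ 'd) pmf)"
  define S where "S = (srw_increments :: (nat \<Rightarrow> int ^ 'd) measure)"
  interpret S: prob_space S unfolding S_def by (rule prob_space_srw_increments)
  interpret p: prob_space p unfolding p_def by (rule measure_pmf.prob_space_axioms)
  interpret pS: pair_prob_space p S ..
  interpret W: sequence_space p ..
  have iter: "distr (p \<Otimes>\<^sub>M S) S (\<lambda>(e, \<xi>). case_nat e \<xi>) = S"
    unfolding S_def srw_increments_def p_def[symmetric] by (rule W.PiM_iter)
  have case_meas: "(\<lambda>(e, \<xi>). case_nat e \<xi>) \<in> p \<Otimes>\<^sub>M S \<rightarrow>\<^sub>M S"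
    unfolding p_def S_def srw_increments_def by measurable
  have meas': "(\<lambda>\<xi>. f (x + \<xi> 0) (\<lambda>k. \<xi> (Suc k))) \<in> borel_measurable S"
    unfolding S_def by (rule measurable_after_first_step[OF meas])
  have "(\<lambda>z. f (x + fst z) (snd z)) = (\<lambda>\<xi>. f (x + \<xi> 0) (\<lambda>k. \<xi> (Suc k))) \<circ> (\<lambda>(e, \<xi>). case_nat e \<xi>)"
    by (auto simp: fun_eq_iff)
  then have meas2: "(\<lambda>z. f (x + fst z) (snd z)) \<in> borel_measurable (p \<Otimes>\<^sub>M S)"
    using measurable_comp[OF case_meas meas'] by simp
  have int: "integrable (p \<Otimes>\<^sub>M S) (\<lambda>(e, \<xi>). f (x + e) \<xi>)"
    using meas2 bounds
    by (intro pS.P.integrable_const_bound[of _ 1]) (auto simp: case_prod_beta' abs_of_nonneg)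
  have "(\<integral>\<xi>. f (x + \<xi> 0) (\<lambda>k. \<xi> (Suc k)) \<partial>S) =
      (\<integral>\<xi>. f (x + \<xi> 0) (\<lambda>k. \<xi> (Suc k)) \<partial>distr (p \<Otimes>\<^sub>M S) S (\<lambda>(e, \<xi>). case_nat e \<xi>))"
    unfolding iter ..
  also have "\<dots> = (\<integral>z. (case z of (e, \<xi>) \<Rightarrow> f (x + e) \<xi>) \<partial>(p \<Otimes>\<^sub>M S))"
    by (subst integral_distr[OF case_meas meas']) (simp add: case_prod_beta')
  also have "\<dots> = (\<integral>e. (\<integral>\<xi>. f (x + e) \<xi> \<partial>S) \<partial>p)"
    by (rule pS.integral_fst'[OF int, symmetric, unfolded split_conv])
  finally show ?thesis
    by (simp add: p_def expectation_srw_step S_def)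
qed

lemma travel_weight_eq: "travel_weight x y \<omega> = (\<integral>\<xi>. path_weight y \<omega> x \<xi> \<partial>srw_increments)"
  by (simp add: travel_weight_def path_weight_def)

lemma travel_weight_self:
  fixes y :: "int ^ 'd::finite"
  shows "travel_weight y y \<omega> = 1"
proof -
  interpret prob_space "srw_increments :: (nat \<Rightarrow> int ^ 'd) measure"
    by (rule prob_space_srw_increments)
  show ?thesis by (simp add: travel_weight_eq path_weight_start prob_space)
qed

lemma travel_weight_nonneg: "0 \<le> travel_weight x y \<omega>"
  by (simp add: travel_weight_eq path_weight_nonneg)

lemma travel_weight_le_1:
  fixes \<omega> :: "int ^ 'd::finite \<Rightarrow> real"
  assumes "\<And>x. 0 \<le> \<omega> x"
  shows "travel_weight x y \<omega> \<le> 1"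
proof -
  interpret prob_space "srw_increments :: (nat \<Rightarrow> int ^ 'd) measure"
    by (rule prob_space_srw_increments)
  have "integrable srw_increments (path_weight y \<omega> x)"
    by (intro integrable_const_bound[of _ 1])
       (auto simp: path_weight_nonneg path_weight_le_1 assms abs_of_nonneg)
  then show ?thesis
    unfolding travel_weight_eq by (rule integral_le_const) (simp add: path_weight_le_1 assms)
qed

lemma travel_weight_step:
  fixes x y :: "int ^ 'd::finite"
  assumes nonneg: "\<And>x. 0 \<le> \<omega> x" and "x \<noteq> y"
  shows "travel_weight x y \<omega> =
    exp (- \<omega> x) * ((\<Sum>e\<in>steps. travel_weight (x + e) y \<omega>) / card (steps :: (int ^ 'd) set))"
proof -
  have "path_weight y \<omega> x = (\<lambda>\<xi>. exp (- \<omega> x) * path_weight y \<omega> (x + \<xi> 0) (\<lambda>k. \<xi> (Suc k)))"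
    by (rule ext) (rule path_weight_step[OF \<open>x \<noteq> y\<close>])
  then show ?thesis
    using integral_first_step[of "path_weight y \<omega>" x]
    by (simp add: travel_weight_eq path_weight_nonneg path_weight_le_1 nonneg)
qed

text \<open>
  The travel weight is the smallest nonnegative function that is at least \<open>1\<close> at \<open>y\<close> and satisfies
  the first-step relation as an inequality elsewhere: such a function dominates each truncation, by
  induction on the horizon. Every upper bound on the travel weight below is obtained by exhibiting
  such a function.
\<close>

lemma travel_weight_le_supersolution:
  fixes y :: "int ^ 'd::finite"
  assumes nonneg: "\<And>x. 0 \<le> \<omega> x"
    and u_nonneg: "\<And>x. 0 \<le> u x" and u_y: "1 \<le> u y"
    and super: "\<And>x. x \<noteq> y \<Longrightarrow>
      exp (- \<omega> x) * ((\<Sum>e\<in>steps. u (x + e)) / card (steps :: (int ^ 'd) set)) \<le> u x"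
  shows "travel_weight x y \<omega> \<le> u x"
proof -
  interpret S: prob_space "srw_increments :: (nat \<Rightarrow> int ^ 'd) measure"
    by (rule prob_space_srw_increments)
  have bounds: "0 \<le> truncated_weight y \<omega> n x \<xi>" "truncated_weight y \<omega> n x \<xi> \<le> 1" for n x \<xi>
    by (auto simp: truncated_weight_eq path_weight_nonneg path_weight_le_1 nonneg)
  have trunc: "(\<integral>\<xi>. truncated_weight y \<omega> n x \<xi> \<partial>srw_increments) \<le> u x" for n x
  proof (induction n arbitrary: x)
    case 0
    then show ?case using u_nonneg u_y by (simp add: S.prob_space)
  next
    case (Suc n)
    show ?case
    proof (cases "x = y")
      case True
      then show ?thesis using u_y by (simp add: S.prob_space)
    next
      case False
      have "(\<integral>\<xi>. truncated_weight y \<omega> (Suc n) x \<xi> \<partial>srw_increments) =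
         exp (- \<omega> x) * ((\<Sum>e\<in>steps. \<integral>\<xi>. truncated_weight y \<omega> n (x + e) \<xi> \<partial>srw_increments) /
           card (steps :: (int ^ 'd) set))"
        using False integral_first_step[of "truncated_weight y \<omega> n" x] bounds by simp
      also have "\<dots> \<le> exp (- \<omega> x) * ((\<Sum>e\<in>steps. u (x + e)) / card (steps :: (int ^ 'd) set))"
        by (intro mult_left_mono divide_right_mono sum_mono Suc.IH) auto
      also have "\<dots> \<le> u x" by (rule super[OF False])
      finally show ?thesis .
    qed
  qed
  have "(\<lambda>n. \<integral>\<xi>. truncated_weight y \<omega> n x \<xi> \<partial>srw_increments) \<longlonglongrightarrow>
      (\<integral>\<xi>. path_weight y \<omega> x \<xi> \<partial>srw_increments)"
    by (rule integral_dominated_convergence[where w = "\<lambda>_. 1"])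
       (auto simp: truncated_weight_tendsto bounds)
  then show ?thesis
    unfolding travel_weight_eq by (rule LIMSEQ_le_const2) (auto intro: trunc)
qed

text \<open>
  A Harnack inequality: with probability \<open>1 / card steps\<close> the first step of the walk goes to the
  given neighbour.
\<close>

lemma travel_weight_neighbour:
  fixes x y :: "int ^ 'd::finite"
  assumes nonneg: "\<And>x. 0 \<le> \<omega> x" and "x \<noteq> y" and "e \<in> steps"
  shows "exp (- \<omega> x) * travel_weight (x + e) y \<omega> \<le> card (steps :: (int ^ 'd) set) * travel_weight x y \<omega>"
proof -
  have "travel_weight (x + e) y \<omega> \<le> (\<Sum>e\<in>steps. travel_weight (x + e) y \<omega>)"
    by (rule member_le_sum[OF \<open>e \<in> steps\<close> _ finite_steps]) (simp add: travel_weight_nonneg)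
  then show ?thesis
    using card_steps_pos[where 'd = 'd] 
    by (subst travel_weight_step[OF nonneg \<open>x \<noteq> y\<close>]) (simp add: field_simps)
qed

definition site_dist :: "int ^ 'd::finite \<Rightarrow> int ^ 'd \<Rightarrow> nat" where
  "site_dist x z = (\<Sum>i\<in>UNIV. nat \<bar>x $ i - z $ i\<bar>)"

lemma exists_step_towards:
  fixes x z :: "int ^ 'd::finite"
  assumes "x \<noteq> z"
  obtains e where "e \<in> steps"
    "site_dist x z = Suc (site_dist (x + e) z)"
    "\<And>i. min (x $ i) (z $ i) \<le> (x + e) $ i" "\<And>i. (x + e) $ i \<le> max (x $ i) (z $ i)"
proof -
  obtain i where i: "x $ i \<noteq> z $ i" using assms by (auto simp: vec_eq_iff)
  define s :: int where "s = (if x $ i < z $ i then 1 else - 1)"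
  define e :: "int ^ 'd" where "e = axis i s"
  have "e \<in> steps" by (auto simp: e_def s_def steps_def)
  moreover have "nat \<bar>x $ i - z $ i\<bar> = Suc (nat \<bar>(x + e) $ i - z $ i\<bar>)"
    using i by (auto simp: e_def s_def axis_def)
  then have "site_dist x z = Suc (site_dist (x + e) z)"
    unfolding site_dist_def by (subst (1 2) sum.remove[of _ i]) (auto simp: e_def axis_def)
  moreover have "min (x $ j) (z $ j) \<le> (x + e) $ j" "(x + e) $ j \<le> max (x $ j) (z $ j)" for j
    using i by (auto simp: e_def s_def axis_def)
  ultimately show ?thesis by (rule that)
qed

text \<open>
  Positivity is what makes the logarithm in the travel cost meaningful; it propagates from \<open>y\<close>
  along a shortest path by the Harnack inequality.
\<close>

lemma travel_weight_pos:
  fixes x y :: "int ^ 'd::finite"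
  assumes nonneg: "\<And>x. 0 \<le> \<omega> x"
  shows "0 < travel_weight x y \<omega>"
proof (induction "site_dist x y" arbitrary: x rule: less_induct)
  case less
  show ?case
  proof (cases "x = y")
    case True
    then show ?thesis by (simp add: travel_weight_self)
  next
    case False
    then obtain e where e: "e \<in> steps"
      "site_dist x y = Suc (site_dist (x + e) y)"
      by (rule exists_step_towards)
    have "0 < exp (- \<omega> x) * travel_weight (x + e) y \<omega>"
      using less e by simp
    also have "\<dots> \<le> card (steps :: (int ^ 'd) set) * travel_weight x y \<omega>"
      by (rule travel_weight_neighbour[OF nonneg False e(1)])
    finally show ?thesis
      by (simp add: zero_less_mult_iff)
  qed
qed

section \<open>A supersolution for the larger potential\<close>

definition box_index :: "nat \<Rightarrow> int ^ 'd::finite \<Rightarrow> int ^ 'd" where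
  "box_index L x = (\<chi> i. x $ i div int L)"

text \<open>
  Boxes are convex for the \<open>\<ell>\<^sup>1\<close> geometry, so a shortest path between two of their sites stays inside.
\<close>

lemma box_index_between:
  assumes "box_index L x = box_index L z"
    and "\<And>i. min (x $ i) (z $ i) \<le> x' $ i" "\<And>i. x' $ i \<le> max (x $ i) (z $ i)"
  shows "box_index L x' = box_index L z"
  unfolding box_index_def vec_eq_iff vec_lambda_beta
proof
  fix i
  have eq: "x $ i div int L = z $ i div int L"
    using assms(1) by (simp add: box_index_def vec_eq_iff)
  have "x' $ i div int L \<le> max (x $ i) (z $ i) div int L"
    "min (x $ i) (z $ i) div int L \<le> x' $ i div int L"
    using assms(2,3)[of i] by (cases "L = 0"; simp add: zdiv_mono1)+
  then show "x' $ i div int L = z $ i div int L"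
    using eq by (auto simp: max_def min_def split: if_splits)
qed

lemma box_diameter:
  fixes x z :: "int ^ 'd::finite"
  assumes "L > 0" "box_index L x = box_index L z"
  shows "site_dist x z \<le> CARD('d) * L"
proof -
  have "nat \<bar>x $ i - z $ i\<bar> \<le> L" for i
  proof -
    have "x $ i div int L = z $ i div int L"
      using assms(2) by (simp add: box_index_def vec_eq_iff)
    then have "x $ i - z $ i = x $ i mod int L - z $ i mod int L"
      by (metis add_diff_cancel_left mult_div_mod_eq)
    moreover have "0 \<le> x $ i mod int L" "x $ i mod int L < int L"
      "0 \<le> z $ i mod int L" "z $ i mod int L < int L"
      using assms(1) by simp_all
    ultimately show ?thesis by linarith
  qed
  then have "site_dist x z \<le> (\<Sum>i\<in>(UNIV :: 'd set). L)"
    unfolding site_dist_def by (intro sum_mono)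
  then show ?thesis by simp
qed

text \<open>
  A single site with \<open>\<omega>F \<ge> \<omega>G + \<delta>\<close> in a box does not force a path through that box to feel the
  difference, since the path may avoid the site. But the walk weighted by \<open>\<omega>G\<close> hits the site with a
  probability bounded below once it is in the box, because there \<open>\<omega>G \<le> M\<close>. Analytically, the penalty at
  the site \<open>z\<close> is spread over its whole box: multiply the travel weight \<open>h\<close> of \<open>\<omega>G\<close> by the
  corrector \<open>\<psi> x = 1 - \<eta> \<theta>\<^bsup>|x - z|\<^esup>\<close> inside good boxes and by \<open>1\<close> outside. Off the marked sites
  \<open>\<psi>\<close> is strictly superharmonic inside a good box for the walk conditioned by \<open>h\<close>, and its
  minimum \<open>1 - \<eta> = exp (- \<delta> / 2)\<close> at \<open>z\<close> is paid for by half of the gap \<open>\<delta>\<close>. The slack that is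
  left pays for a factor \<open>exp \<gamma>\<close> at every site of a good box. Hence \<open>\<psi> h exp (- \<gamma> T)\<close> is a
  supersolution for \<open>\<omega>F\<close> whenever a step decreases \<open>T\<close> by at most \<open>1\<close> if it starts in a good
  box, and not at all otherwise.
\<close>

lemma travel_weight_box_comparison:
  fixes \<omega>F \<omega>G :: "int ^ 'd::finite \<Rightarrow> real" and T :: "int ^ 'd \<Rightarrow> real"
    and good :: "int ^ 'd \<Rightarrow> bool" and M \<delta> :: real and L :: nat
  defines "N \<equiv> real (card (steps :: (int ^ 'd) set))"
  defines "\<theta> \<equiv> exp (- 2 * M) / (2 * N\<^sup>2)"
  defines "\<gamma> \<equiv> min (\<delta> / 2) ((1 - exp (- \<delta> / 2)) * \<theta> ^ (CARD('d) * L))"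
  assumes "L > 0" "\<delta> > 0" "M \<ge> 0"
    and nonneg: "\<And>x. 0 \<le> \<omega>G x" and le: "\<And>x. \<omega>G x \<le> \<omega>F x"
    and good_gap: "\<And>v. good v \<Longrightarrow> \<exists>z. box_index L z = v \<and> \<omega>G z + \<delta> \<le> \<omega>F z"
    and good_le: "\<And>x. good (box_index L x) \<Longrightarrow> \<omega>G x \<le> M"
    and T_nonneg: "\<And>x. 0 \<le> T x" and T_y: "T y = 0"
    and T_step: "\<And>x e. e \<in> steps \<Longrightarrow> T x \<le> of_bool (good (box_index L x)) + T (x + e)"
  shows "travel_weight x y \<omega>F \<le> exp (\<delta> / 2) * exp (- \<gamma> * T x) * travel_weight x y \<omega>G"
proof -
  define \<eta> where "\<eta> = 1 - exp (- \<delta> / 2)"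
  have \<eta>: "0 < \<eta>" "\<eta> < 1"
    using \<open>\<delta> > 0\<close> by (auto simp: \<eta>_def)
  have N: "N \<ge> 1"
    using card_steps_pos[where 'd = 'd] by (simp add: N_def)
  have N2: "2 * N\<^sup>2 \<ge> 1"
    using one_le_power[OF N, of 2] by linarith
  have \<theta>: "0 < \<theta>" "\<theta> \<le> 1"
  proof -
    show "0 < \<theta>" using N by (simp add: \<theta>_def)
    have "exp (- 2 * M) \<le> 1" using \<open>M \<ge> 0\<close> by simp
    also have "1 \<le> 2 * N\<^sup>2" by (rule N2)
    finally show "\<theta> \<le> 1" using N by (simp add: \<theta>_def)
  qed
  have \<gamma>: "0 \<le> \<gamma>" "\<gamma> \<le> \<delta> / 2"
    using \<eta> \<theta> \<open>\<delta> > 0\<close> by (auto simp: \<gamma>_def \<eta>_def[symmetric])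
  obtain z where z: "\<And>v. good v \<Longrightarrow> box_index L (z v) = v"
    "\<And>v. good v \<Longrightarrow> \<omega>G (z v) + \<delta> \<le> \<omega>F (z v)"
    using good_gap by metis
  define g where "g x = good (box_index L x)" for x
  define D where "D x = site_dist x (z (box_index L x))" for x
  define \<phi> where "\<phi> x = (if g x then \<theta> ^ D x else 0)" for x
  define \<psi> where "\<psi> x = 1 - \<eta> * \<phi> x" for x
  define h where "h x = travel_weight x y \<omega>G" for x
  define u where "u x = exp (\<delta> / 2) * (\<psi> x * h x * exp (- \<gamma> * T x))" for x
  have \<phi>: "0 \<le> \<phi> x" "\<phi> x \<le> 1" for x
    using \<theta> by (auto simp: \<phi>_def power_le_one)
  have \<psi>_le: "\<psi> x \<le> 1" for x
    using \<phi> \<eta> by (simp add: \<psi>_def)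
  have \<psi>_ge: "exp (- \<delta> / 2) \<le> \<psi> x" for x
  proof -
    have "\<eta> * \<phi> x \<le> \<eta> * 1"
      using \<eta> \<phi> by (intro mult_left_mono) auto
    moreover have "exp (- \<delta> / 2) = 1 - \<eta>" by (simp add: \<eta>_def)
    ultimately show ?thesis
      unfolding \<psi>_def by linarith
  qed
  then have \<psi>_pos: "0 < \<psi> x" for x
    using exp_gt_zero less_le_trans by blast
  have h_pos: "0 < h x" for x
    unfolding h_def using nonneg by (rule travel_weight_pos)
  have h_le: "h x \<le> 1" for x
    unfolding h_def using nonneg by (rule travel_weight_le_1)
  \<comment> \<open>The supersolution inequality without the factor \<open>exp (- \<gamma> T)\<close>, in which a good box costs an
    additional \<open>\<gamma>\<close>.\<close>
  have super_local: "exp (- \<omega>F x) * exp (\<gamma> * of_bool (g x)) * (\<Sum>e\<in>steps. \<psi> (x + e) * h (x + e)) \<le>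
      \<psi> x * exp (- \<omega>G x) * (\<Sum>e\<in>steps. h (x + e))" (is "_ * _ * ?W \<le> _ * _ * ?H")
    if "x \<noteq> y" for x
  proof -
    have W_le: "?W \<le> ?H"
      using \<psi>_le h_pos by (intro sum_mono) (simp add: mult_left_le_one_le \<psi>_pos less_imp_le)
    have W_nonneg: "0 \<le> ?W"
      using \<psi>_pos h_pos by (intro sum_nonneg) (simp add: less_imp_le)
    have "exp (\<gamma> * of_bool (g x)) * exp (\<omega>G x - \<omega>F x) * ?W \<le> \<psi> x * ?H"
    proof (cases "g x")
      case False
      have "exp (\<omega>G x - \<omega>F x) * ?W \<le> 1 * ?H"
        using le[of x] W_le W_nonneg by (intro mult_mono) auto
      then show ?thesis using False by (simp add: \<psi>_def \<phi>_def)
    next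
      case True
      show ?thesis
      \<comment> \<open>At the marked site half of the gap absorbs \<open>\<gamma>\<close> and the other half the low value of \<open>\<psi>\<close>;
        elsewhere in the box the neighbour closer to the marked site has a smaller \<open>\<psi>\<close>.\<close>
      proof (cases "x = z (box_index L x)")
        case x: True
        have "exp (\<gamma> * of_bool (g x)) * exp (\<omega>G x - \<omega>F x) = exp (\<gamma> + (\<omega>G x - \<omega>F x))"
          using True by (simp add: exp_add)
        also have "\<dots> \<le> exp (- \<delta> / 2)"
          using z(2)[of "box_index L x"] True \<gamma>(2) x by (simp add: g_def)
        also have "\<dots> \<le> \<psi> x" by (rule \<psi>_ge)
        finally show ?thesis
          using W_le W_nonneg \<psi>_pos[of x] by (intro mult_mono) auto
      next
        case x: False
        let ?z = "z (box_index L x)"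
        obtain e where e: "e \<in> steps"
          "site_dist x ?z = Suc (site_dist (x + e) ?z)"
          "\<And>i. min (x $ i) (?z $ i) \<le> (x + e) $ i" "\<And>i. (x + e) $ i \<le> max (x $ i) (?z $ i)"
          by (rule exists_step_towards[OF x]) auto
        have z_box: "box_index L ?z = box_index L x"
          using True z(1) by (simp add: g_def)
        have e_box: "box_index L (x + e) = box_index L x"
          using box_index_between[of L x ?z "x + e"] z_box e(3,4) by simp
        have D_e: "D x = Suc (D (x + e))"
          using e(2) by (simp add: D_def e_box)
        have g_e: "g (x + e)" using True by (simp add: g_def e_box)
        have h_x: "h x = exp (- \<omega>G x) * (?H / N)"
          unfolding h_def N_def by (rule travel_weight_step[OF nonneg \<open>x \<noteq> y\<close>])
        have H: "?H = N * exp (\<omega>G x) * h x"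
          using N by (simp add: h_x exp_minus field_simps)
        \<comment> \<open>If the neighbour is \<open>y\<close> itself, first-step analysis fails there, but \<open>h y = 1\<close> is the maximum of \<open>h\<close>.\<close>
        have h_nb: "h x \<le> N * exp M * h (x + e)"
        proof (cases "x + e = y")
          case True
          have "h x \<le> 1 * 1 * 1" using h_le by simp
          also have "\<dots> \<le> N * exp M * h (x + e)"
            using N \<open>M \<ge> 0\<close> True by (intro mult_mono) (auto simp: h_def travel_weight_self)
          finally show ?thesis .
        next
          case False
          have "exp (- \<omega>G (x + e)) * h (x + e + (- e)) \<le> N * h (x + e)"
            unfolding h_def N_def
            by (rule travel_weight_neighbour[OF nonneg False uminus_steps[OF e(1)]])
          then have "h x \<le> N * exp (\<omega>G (x + e)) * h (x + e)"
            by (simp add: exp_minus field_simps)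
          also have "\<dots> \<le> N * exp M * h (x + e)"
            using good_le[of "x + e"] g_e N h_pos[of "x + e"]
            by (intro mult_right_mono mult_left_mono) (auto simp: g_def)
          finally show ?thesis .
        qed
        \<comment> \<open>The conditioned walk moves to that neighbour with probability at least \<open>2 \<theta>\<close>. As \<open>1 - \<psi>\<close> is larger
          by the factor \<open>1 / \<theta>\<close> there, the average of \<open>1 - \<psi>\<close> is at least twice its value at \<open>x\<close>.\<close>
        have "2 * \<theta> * ?H \<le> h (x + e)"
        proof -
          have "?H \<le> N * exp M * h x"
            unfolding H using good_le[of x] True N h_pos[of x]
            by (intro mult_right_mono mult_left_mono) (auto simp: g_def)
          also have "\<dots> \<le> N * exp M * (N * exp M * h (x + e))"
            using h_nb N by (intro mult_left_mono) auto
          also have "\<dots> = h (x + e) / (2 * \<theta>)"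
            using N by (simp add: \<theta>_def field_simps power2_eq_square exp_minus exp_add[symmetric])
          finally show ?thesis using \<theta> by (simp add: field_simps)
        qed
        then have "\<eta> * \<theta> ^ D (x + e) * (2 * \<theta> * ?H) \<le> \<eta> * \<theta> ^ D (x + e) * h (x + e)"
          using \<eta> \<theta> by (intro mult_left_mono) auto
        also have "\<dots> = \<eta> * \<phi> (x + e) * h (x + e)"
          using g_e by (simp add: \<phi>_def)
        also have "\<dots> \<le> (\<Sum>e\<in>steps. \<eta> * \<phi> (x + e) * h (x + e))"
          using \<eta> \<phi> h_pos
          by (intro member_le_sum[OF e(1) _ finite_steps]) (simp add: less_imp_le)
        also have "\<dots> = ?H - ?W"
          by (simp add: \<psi>_def algebra_simps sum_subtractf)
        finally have W: "?W \<le> (1 - 2 * \<eta> * \<theta> ^ D x) * ?H"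
          by (simp add: D_e algebra_simps)
        have D_le: "D x \<le> CARD('d) * L"
          unfolding D_def by (rule box_diameter[OF \<open>L > 0\<close> z_box[symmetric]])
        have "\<gamma> \<le> \<eta> * \<theta> ^ (CARD('d) * L)"
          by (simp add: \<gamma>_def \<eta>_def)
        also have "\<dots> \<le> \<eta> * \<theta> ^ D x"
          using D_le \<theta> \<eta> by (intro mult_left_mono power_decreasing) auto
        finally have \<gamma>_le: "\<gamma> \<le> \<eta> * \<theta> ^ D x" .
        have \<psi>_x: "\<psi> x = 1 - \<eta> * \<theta> ^ D x"
          using True by (simp add: \<psi>_def \<phi>_def)
        have "1 - 2 * \<eta> * \<theta> ^ D x \<le> \<psi> x * (1 - \<gamma>)"
        proof -
          have "\<psi> x * \<gamma> \<le> 1 * \<gamma>"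
            using \<psi>_le \<gamma> by (intro mult_right_mono) auto
          then show ?thesis using \<gamma>_le by (simp add: \<psi>_x algebra_simps)
        qed
        also have "\<dots> \<le> \<psi> x * exp (- \<gamma>)"
          using exp_ge_add_one_self[of "- \<gamma>"] \<psi>_pos[of x] by (intro mult_left_mono) auto
        finally have "exp \<gamma> * (1 - 2 * \<eta> * \<theta> ^ D x) \<le> \<psi> x"
          by (simp add: exp_minus field_simps)
        moreover have "?H \<ge> 0"
          using h_pos by (intro sum_nonneg) (simp add: less_imp_le)
        ultimately have "exp \<gamma> * (1 - 2 * \<eta> * \<theta> ^ D x) * ?H \<le> \<psi> x * ?H"
          by (intro mult_right_mono)
        then have "exp \<gamma> * ?W \<le> \<psi> x * ?H"
          using mult_left_mono[OF W, of "exp \<gamma>", OF exp_ge_zero] by (simp only: mult.assoc)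
        have "exp \<gamma> * exp (\<omega>G x - \<omega>F x) * ?W = exp (\<omega>G x - \<omega>F x) * (exp \<gamma> * ?W)"
          by simp
        also have "\<dots> \<le> 1 * (exp \<gamma> * ?W)"
          using le[of x] W_nonneg by (intro mult_right_mono) auto
        also have "\<dots> \<le> \<psi> x * ?H"
          using \<open>exp \<gamma> * ?W \<le> \<psi> x * ?H\<close> by simp
        finally show ?thesis
          using True by (simp only: of_bool_eq mult_1_right)
      qed
    qed
    then have "exp (- \<omega>G x) * (exp (\<gamma> * of_bool (g x)) * exp (\<omega>G x - \<omega>F x) * ?W) \<le>
        exp (- \<omega>G x) * (\<psi> x * ?H)"
      by (intro mult_left_mono) auto
    moreover have "exp (- \<omega>F x) = exp (- \<omega>G x) * exp (\<omega>G x - \<omega>F x)"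
      by (simp add: exp_add[symmetric])
    then have "exp (- \<omega>F x) * exp (\<gamma> * of_bool (g x)) * ?W =
        exp (- \<omega>G x) * (exp (\<gamma> * of_bool (g x)) * exp (\<omega>G x - \<omega>F x) * ?W)"
      by (simp only: mult_ac)
    moreover have "\<psi> x * exp (- \<omega>G x) * ?H = exp (- \<omega>G x) * (\<psi> x * ?H)"
      by (simp only: mult_ac)
    ultimately show ?thesis by argo
  qed
  have "travel_weight x y \<omega>F \<le> u x"
  proof (rule travel_weight_le_supersolution)
    show "0 \<le> \<omega>F x" for x using nonneg le order_trans by blast
    show "0 \<le> u x" for x using \<psi>_pos h_pos by (simp add: u_def less_imp_le)
    have "exp (\<delta> / 2) * exp (- \<delta> / 2) \<le> exp (\<delta> / 2) * \<psi> y"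
      using \<psi>_ge by (intro mult_left_mono) auto
    then show "1 \<le> u y"
      by (simp add: u_def T_y h_def travel_weight_self exp_add[symmetric])
  next
    fix x assume "x \<noteq> y"
    have "(\<Sum>e\<in>steps. u (x + e)) \<le>
      (\<Sum>e\<in>steps. exp (\<delta> / 2) * exp (- \<gamma> * T x) * exp (\<gamma> * of_bool (g x)) * (\<psi> (x + e) * h (x + e)))"
    proof (rule sum_mono)
      fix e :: "int ^ 'd" assume "e \<in> steps"
      have "\<gamma> * T x \<le> \<gamma> * (of_bool (g x) + T (x + e))"
        using T_step[OF \<open>e \<in> steps\<close>] \<gamma>(1) unfolding g_def by (intro mult_left_mono)
      then have "exp (- \<gamma> * T (x + e)) \<le> exp (- \<gamma> * T x + \<gamma> * of_bool (g x))"
        by (simp add: algebra_simps)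
      then have "exp (- \<gamma> * T (x + e)) \<le> exp (- \<gamma> * T x) * exp (\<gamma> * of_bool (g x))"
        unfolding exp_add .
      then have "exp (\<delta> / 2) * (\<psi> (x + e) * h (x + e)) * exp (- \<gamma> * T (x + e)) \<le>
          exp (\<delta> / 2) * (\<psi> (x + e) * h (x + e)) * (exp (- \<gamma> * T x) * exp (\<gamma> * of_bool (g x)))"
        using \<psi>_pos h_pos by (intro mult_left_mono) (auto simp: less_imp_le)
      then show "u (x + e) \<le>
          exp (\<delta> / 2) * exp (- \<gamma> * T x) * exp (\<gamma> * of_bool (g x)) * (\<psi> (x + e) * h (x + e))"
        by (simp add: u_def mult_ac)
    qed
    then have "exp (- \<omega>F x) * ((\<Sum>e\<in>steps. u (x + e)) / N) \<le> exp (- \<omega>F x) *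
      ((\<Sum>e\<in>steps. exp (\<delta> / 2) * exp (- \<gamma> * T x) * exp (\<gamma> * of_bool (g x)) * (\<psi> (x + e) * h (x + e))) / N)"
      using N by (intro mult_left_mono divide_right_mono) auto
    also have "\<dots> = exp (\<delta> / 2) * exp (- \<gamma> * T x) / N *
      (exp (- \<omega>F x) * exp (\<gamma> * of_bool (g x)) * (\<Sum>e\<in>steps. \<psi> (x + e) * h (x + e)))"
      by (simp add: sum_distrib_left[symmetric])
    also have "\<dots> \<le> exp (\<delta> / 2) * exp (- \<gamma> * T x) / N *
      (\<psi> x * exp (- \<omega>G x) * (\<Sum>e\<in>steps. h (x + e)))"
      using N by (intro mult_left_mono super_local[OF \<open>x \<noteq> y\<close>]) auto
    also have "\<dots> = exp (\<delta> / 2) * exp (- \<gamma> * T x) * \<psi> x * (exp (- \<omega>G x) * ((\<Sum>e\<in>steps. h (x + e)) / N))"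
      by simp
    also have "exp (- \<omega>G x) * ((\<Sum>e\<in>steps. h (x + e)) / N) = h x"
      unfolding h_def N_def by (rule travel_weight_step[OF nonneg \<open>x \<noteq> y\<close>, symmetric])
    also have "exp (\<delta> / 2) * exp (- \<gamma> * T x) * \<psi> x * h x = u x"
      by (simp add: u_def)
    finally show "exp (- \<omega>F x) * ((\<Sum>e\<in>steps. u (x + e)) / card (steps :: (int ^ 'd) set)) \<le> u x"
      by (simp add: N_def)
  qed
  also have "u x \<le> exp (\<delta> / 2) * (1 * h x * exp (- \<gamma> * T x))"
    unfolding u_def using \<psi>_le h_pos
    by (intro mult_left_mono mult_right_mono) (auto simp: less_imp_le)
  finally show ?thesis by (simp add: h_def mult_ac)
qed

section \<open>Counting good boxes along coarse paths\<close>

text \<open>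
  Self-avoiding paths: distinct boxes depend on disjoint sets of sites, hence are independent.
\<close>

definition coarse_path :: "(int ^ 'd::finite) list \<Rightarrow> bool" where
  "coarse_path p \<longleftrightarrow> p \<noteq> [] \<and> distinct p \<and> successively (\<lambda>a b. b - a \<in> steps) p"

definition path_between :: "int ^ 'd::finite \<Rightarrow> int ^ 'd \<Rightarrow> (int ^ 'd) list \<Rightarrow> bool" where
  "path_between v w p \<longleftrightarrow> coarse_path p \<and> hd p = v \<and> last p = w"

text \<open>
  A first-passage distance on the lattice of boxes. The end point is excluded from the count so that
  the distance vanishes there; a path ends at the site \<open>y\<close> without having to cross its box.
\<close>

definition good_count ::
  "(int ^ 'd::finite \<Rightarrow> bool) \<Rightarrow> int ^ 'd \<Rightarrow> int ^ 'd \<Rightarrow> nat" where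
  "good_count good w v =
     (LEAST k. \<exists>p. path_between v w p \<and> k = card {a \<in> set p - {w}. good a})"

lemma path_between_self: "path_between w w [w]"
  by (simp add: path_between_def coarse_path_def)

text \<open>
  Loop erasure: if the new vertex already lies on the path, the part before its occurrence is dropped.
\<close>

lemma path_between_extend:
  assumes "path_between v' w p" "v' - v \<in> steps"
  obtains p' where "path_between v w p'" "set p' \<subseteq> insert v (set p)"
proof (cases "v \<in> set p")
  case True
  then obtain as bs where p: "p = as @ v # bs" by (meson split_list)
  have "path_between v w (v # bs)"
    using assms(1) by (auto simp: p path_between_def coarse_path_def successively_append_iff)
  then show ?thesis by (rule that) (auto simp: p)
next
  case False
  have "path_between v w (v # p)"
    using assms False by (auto simp: path_between_def coarse_path_def successively_Cons)
  then show ?thesis by (rule that) auto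
qed

lemma path_between_exists: "\<exists>p. path_between v w p"
proof (induction "site_dist v w" arbitrary: v rule: less_induct)
  case less
  show ?case
  proof (cases "v = w")
    case True
    then show ?thesis using path_between_self by blast
  next
    case False
    then obtain e where e: "e \<in> steps" "site_dist v w = Suc (site_dist (v + e) w)"
      by (rule exists_step_towards)
    then obtain p where "path_between (v + e) w p"
      using less[of "v + e"] by auto
    then show ?thesis
      using path_between_extend[of "v + e" w p v] e(1) by auto
  qed
qed

lemma good_count_attained:
  obtains p where "path_between v w p" "good_count good w v = card {a \<in> set p - {w}. good a}"
proof -
  have "\<exists>k p. path_between v w p \<and> k = card {a \<in> set p - {w}. good a}"
    using path_between_exists by blast
  from LeastI_ex[OF this] show ?thesis
    using that unfolding good_count_def by blast
qed

lemma good_count_le: "path_between v w p \<Longrightarrow> good_count good w v \<le> card {a \<in> set p - {w}. good a}"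
  unfolding good_count_def by (rule Least_le) auto

lemma good_count_self: "good_count good w w = 0"
  using good_count_le[OF path_between_self, of good w] by simp

lemma good_count_step:
  assumes "v' - v \<in> steps"
  shows "good_count good w v \<le> of_bool (good v) + good_count good w v'"
proof -
  obtain p where p: "path_between v' w p"
    "good_count good w v' = card {a \<in> set p - {w}. good a}"
    by (rule good_count_attained)
  obtain p' where p': "path_between v w p'" "set p' \<subseteq> insert v (set p)"
    using path_between_extend[OF p(1) assms] .
  have "good_count good w v \<le> card {a \<in> set p' - {w}. good a}"
    by (rule good_count_le[OF p'(1)])
  also have "\<dots> \<le> card ((if good v then {v} else {}) \<union> {a \<in> set p - {w}. good a})"
    using p'(2) by (intro card_mono) auto
  also have "\<dots> \<le> card (if good v then {v} else {}) + card {a \<in> set p - {w}. good a}"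
    by (rule card_Un_le)
  finally show ?thesis using p(2) by (simp split: if_splits)
qed

lemma steps_cases:
  assumes "e \<in> steps"
  obtains i s where "e = axis i s" "\<bar>s\<bar> = 1"
  using assms unfolding steps_def by (elim UnE rangeE) simp_all

lemma site_dist_step:
  assumes "b - a \<in> steps"
  shows "site_dist a w \<le> Suc (site_dist b w)"
proof -
  obtain i s where ax: "b - a = axis i s" "\<bar>s\<bar> = 1"
    using assms by (rule steps_cases)
  have le: "nat \<bar>a $ j - w $ j\<bar> \<le> (if j = i then 1 else 0) + nat \<bar>b $ j - w $ j\<bar>" for j
  proof -
    have "b $ j - a $ j = (if j = i then s else 0)"
      using arg_cong[OF ax(1), of "\<lambda>c. c $ j"] by (simp add: axis_def)
    then show ?thesis using ax(2) by (auto split: if_splits)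
  qed
  have "site_dist a w \<le> (\<Sum>j\<in>UNIV. (if j = i then 1 else 0) + nat \<bar>b $ j - w $ j\<bar>)"
    unfolding site_dist_def by (intro sum_mono le)
  also have "\<dots> = Suc (site_dist b w)"
    by (simp add: sum.distrib site_dist_def)
  finally show ?thesis .
qed

lemma site_dist_less_length:
  "p \<noteq> [] \<Longrightarrow> successively (\<lambda>a b. b - a \<in> steps) p \<Longrightarrow> site_dist (hd p) (last p) < length p"
proof (induction p rule: induct_list012)
  case (3 a b p)
  then have "site_dist a (last (b # p)) \<le> Suc (site_dist b (last (b # p)))"
    by (intro site_dist_step) simp
  with 3 show ?case by auto
qed (simp_all add: site_dist_def)

text \<open>
  The first \<open>m\<close> vertices of a self-avoiding path that is longer than \<open>m\<close> do not contain its end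
  point, so that it suffices to count good boxes on paths of a fixed length that start at \<open>v\<close>.
\<close>

lemma good_count_ge:
  assumes "m > 0" "m \<le> site_dist v w"
    and many: "\<And>p. coarse_path p \<Longrightarrow> hd p = v \<Longrightarrow> length p = m \<Longrightarrow> j \<le> card {a \<in> set p. good a}"
  shows "j \<le> good_count good w v"
proof -
  obtain p where p: "path_between v w p"
    "good_count good w v = card {a \<in> set p - {w}. good a}"
    by (rule good_count_attained)
  have len: "m < length p"
    using site_dist_less_length[of p] assms(2) p(1) by (auto simp: path_between_def coarse_path_def)
  define q where "q = take m p"
  have p_split: "p = q @ drop m p"
    by (simp add: q_def)
  have q: "length q = m" "q \<noteq> []"
    using len \<open>m > 0\<close> by (auto simp: q_def)
  have "coarse_path (q @ drop m p)" "hd (q @ drop m p) = v" "last (q @ drop m p) = w"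
    using p(1) p_split by (auto simp: path_between_def)
  moreover have "drop m p \<noteq> []" using len by simp
  moreover from this have "w \<in> set (drop m p)"
    using \<open>last (q @ drop m p) = w\<close> by (metis last_appendR last_in_set)
  ultimately have "coarse_path q" "hd q = v" "w \<notin> set q"
    using q by (auto simp: coarse_path_def successively_append_iff)
  then have "j \<le> card {a \<in> set q. good a}"
    using many q by blast
  also have "\<dots> \<le> card {a \<in> set p - {w}. good a}"
    using \<open>w \<notin> set q\<close> set_take_subset[of m p] by (intro card_mono) (auto simp: q_def)
  finally show ?thesis using p(2) by simp
qed

lemma div_add_unit:
  fixes a s :: int
  assumes "L > 0" "\<bar>s\<bar> = 1"
  shows "(a + s) div L - a div L \<in> {0, s}"
proof (cases "s = 1")
  case True
  have "a div L \<le> (a + 1) div L" "(a + 1) div L \<le> (a + L) div L"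
    using assms by (intro zdiv_mono1; simp)+
  moreover have "(a + L) div L = a div L + 1" using assms by simp
  ultimately have "(a + 1) div L = a div L \<or> (a + 1) div L = a div L + 1" by linarith
  then show ?thesis using True by auto
next
  case False
  then have s: "s = - 1" using assms by auto
  have "(a - 1) div L \<le> a div L" "a div L \<le> (a - 1 + L) div L"
    using assms by (intro zdiv_mono1; simp)+
  moreover have "(a - 1 + L) div L = (a - 1) div L + 1" using assms by simp
  ultimately have "(a - 1) div L = a div L \<or> (a - 1) div L = a div L - 1" by linarith
  then show ?thesis using s by auto
qed

lemma box_index_step:
  fixes x e :: "int ^ 'd::finite"
  assumes "L > 0" "e \<in> steps"
  shows "box_index L (x + e) = box_index L x \<or> box_index L (x + e) - box_index L x \<in> steps"
proof -
  obtain i s where ax: "e = axis i s" "\<bar>s\<bar> = 1"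
    using assms(2) by (rule steps_cases)
  define t where "t = (x $ i + s) div int L - x $ i div int L"
  have "t \<in> {0, s}"
    unfolding t_def using assms ax by (intro div_add_unit) auto
  have eq: "box_index L (x + e) - box_index L x = axis i t"
    by (simp add: vec_eq_iff box_index_def ax(1) axis_def t_def)
  consider "t = 0" | "t = s" using \<open>t \<in> {0, s}\<close> by blast
  then show ?thesis
  proof cases
    case 1
    then have "axis i t = (0 :: int ^ 'd)" by (simp add: vec_eq_iff axis_def)
    then show ?thesis using eq by (metis eq_iff_diff_eq_0)
  next
    case 2
    then have "t = 1 \<or> t = - 1" using ax(2) by linarith
    then have "axis i t \<in> steps" by (auto simp: steps_def)
    then show ?thesis using eq by simp
  qed
qed

lemma good_count_box_step:
  assumes "L > 0" "e \<in> steps"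
  shows "good_count good w (box_index L x) \<le>
    of_bool (good (box_index L x)) + good_count good w (box_index L (x + e))"
  using box_index_step[OF assms, of x]
proof
  assume "box_index L (x + e) - box_index L x \<in> steps"
  then show ?thesis by (rule good_count_step)
qed simp

lemma finite_coarse_paths: "finite {p. coarse_path p \<and> hd p = v \<and> length p = m}"
  and card_coarse_paths:
    "card {p :: (int ^ 'd::finite) list. coarse_path p \<and> hd p = v \<and> length p = m} \<le>
      card (steps :: (int ^ 'd) set) ^ m"
proof -
  have "finite {p. coarse_path p \<and> hd p = v \<and> length p = m} \<and>
    card {p. coarse_path p \<and> hd p = v \<and> length p = m} \<le> card (steps :: (int ^ 'd) set) ^ m"
  proof (induction m arbitrary: v)
    case 0
    have "{p. coarse_path p \<and> hd p = v \<and> length p = 0} = {}"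
      by (auto simp: coarse_path_def)
    then show ?case by (metis card.empty finite.emptyI zero_le)
  next
    case (Suc m)
    let ?P = "\<lambda>v m. {p. coarse_path p \<and> hd p = v \<and> length p = m}"
    show ?case
    proof (cases "m = 0")
      case True
      have "?P v (Suc m) = {[v]}"
        using True by (auto simp: coarse_path_def length_Suc_conv)
      then show ?thesis
        using card_steps_pos[where 'd = 'd] True by simp
    next
      case False
      have sub: "?P v (Suc m) \<subseteq> (\<Union>e\<in>steps. (#) v ` ?P (v + e) m)"
      proof
        fix p assume "p \<in> ?P v (Suc m)"
        then obtain q where p: "p = v # q" and q: "length q = m" "coarse_path (v # q)"
          by (cases p) auto
        moreover have "q \<noteq> []" using q False by auto
        ultimately have "hd q - v \<in> steps" "coarse_path q"
          by (auto simp: coarse_path_def successively_Cons)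
        then show "p \<in> (\<Union>e\<in>steps. (#) v ` ?P (v + e) m)"
          using p q by (intro UN_I[of "hd q - v"]) auto
      qed
      have fin: "finite (\<Union>e\<in>steps. (#) v ` ?P (v + e) m)"
        using Suc.IH finite_steps by blast
      have "card (?P v (Suc m)) \<le> card (\<Union>e\<in>steps. (#) v ` ?P (v + e) m)"
        by (rule card_mono[OF fin sub])
      also have "\<dots> \<le> (\<Sum>e\<in>steps. card ((#) v ` ?P (v + e) m))"
        by (rule card_UN_le[OF finite_steps])
      also have "\<dots> \<le> (\<Sum>e\<in>(steps :: (int ^ 'd) set). card (steps :: (int ^ 'd) set) ^ m)"
        using Suc.IH by (intro sum_mono order_trans[OF card_image_le]) simp_all
      finally show ?thesis
        using finite_subset[OF sub fin] by simp
    qed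
  qed
  then show "finite {p. coarse_path p \<and> hd p = v \<and> length p = m}"
    "card {p :: (int ^ 'd) list. coarse_path p \<and> hd p = v \<and> length p = m} \<le>
      card (steps :: (int ^ 'd) set) ^ m"
    by blast+
qed

section \<open>Good boxes in an i.i.d. environment\<close>

abbreviation iid_field :: "'s measure \<Rightarrow> (int ^ 'd::finite \<Rightarrow> 's) measure" where
  "iid_field S \<equiv> Pi\<^sub>M UNIV (\<lambda>_. S)"

lemma indep_vars_coordinates:
  fixes S :: "'s measure"
  assumes "prob_space S"
  shows "prob_space.indep_vars (iid_field S :: (int ^ 'd::finite \<Rightarrow> 's) measure) (\<lambda>_. S) (\<lambda>x u. u x) UNIV"
proof -
  interpret P: prob_space "iid_field S :: (int ^ 'd \<Rightarrow> 's) measure"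
    by (intro prob_space_PiM assms)
  have "distr (iid_field S) (iid_field S) (\<lambda>u. \<lambda>x\<in>(UNIV :: (int ^ 'd) set). u x) = iid_field S"
    by (simp add: restrict_def distr_id)
  moreover have "distr (iid_field S) S (\<lambda>u. u x) = S" for x :: "int ^ 'd"
    by (rule distr_PiM_component) (auto intro: assms)
  ultimately show ?thesis
    by (subst P.indep_vars_iff_distr_eq_PiM) auto
qed

definition lattice_box :: "nat \<Rightarrow> int ^ 'd::finite \<Rightarrow> (int ^ 'd) set" where
  "lattice_box L v = {z. box_index L z = v}"

lemma lattice_box_eq_image:
  assumes "L > 0"
  shows "lattice_box L v = vec_lambda ` (\<Pi>\<^sub>E i\<in>UNIV. {int L * v $ i..<int L * v $ i + int L})"
proof -
  have div_iff: "a div int L = b \<longleftrightarrow> int L * b \<le> a \<and> a < int L * b + int L" for a b :: int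
  proof
    assume "a div int L = b"
    then have "a = int L * b + a mod int L" by (metis mult_div_mod_eq)
    moreover have "0 \<le> a mod int L" "a mod int L < int L"
      using assms by simp_all
    ultimately show "int L * b \<le> a \<and> a < int L * b + int L"
      by linarith
  next
    assume "int L * b \<le> a \<and> a < int L * b + int L"
    then show "a div int L = b"
      by (intro int_div_pos_eq[of a "int L" b "a - int L * b"]) auto
  qed
  show ?thesis
  proof (rule set_eqI)
    fix z
    have "z \<in> lattice_box L v \<longleftrightarrow> (\<forall>i. z $ i \<in> {int L * v $ i..<int L * v $ i + int L})"
      by (simp add: lattice_box_def box_index_def vec_eq_iff div_iff)
    also have "\<dots> \<longleftrightarrow> z \<in> vec_lambda ` (\<Pi>\<^sub>E i\<in>UNIV. {int L * v $ i..<int L * v $ i + int L})"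
      by (auto simp: PiE_iff intro!: image_eqI[of _ _ "vec_nth z"])
    finally show "z \<in> lattice_box L v \<longleftrightarrow> z \<in> vec_lambda ` (\<Pi>\<^sub>E i\<in>UNIV. {int L * v $ i..<int L * v $ i + int L})" .
  qed
qed

lemma finite_lattice_box: "L > 0 \<Longrightarrow> finite (lattice_box L v)"
  by (simp add: lattice_box_eq_image finite_PiE)

lemma card_lattice_box:
  fixes v :: "int ^ 'd::finite"
  assumes "L > 0"
  shows "card (lattice_box L v) = L ^ CARD('d)"
  unfolding lattice_box_eq_image[OF assms]
  by (subst card_image) (auto simp: card_PiE inj_on_def vec_lambda_inject)

text \<open>
  The set \<open>A\<close> stands for the single-site values at which the two coupled potentials differ by a fixed
  amount, the set \<open>C\<close> for those at which the smaller potential is bounded. Only the sites of the box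
  itself enter, which makes distinct boxes independent.
\<close>

definition good_box :: "nat \<Rightarrow> 's set \<Rightarrow> 's set \<Rightarrow> (int ^ 'd::finite \<Rightarrow> 's) \<Rightarrow> int ^ 'd \<Rightarrow> bool" where
  "good_box L A C u v \<longleftrightarrow> (\<exists>z\<in>lattice_box L v. u z \<in> A) \<and> (\<forall>z\<in>lattice_box L v. u z \<in> C)"

lemma measurable_good_box:
  assumes A: "A \<in> sets S" and C: "C \<in> sets S" and "L > 0" and "lattice_box L v \<subseteq> I"
  shows "Measurable.pred (Pi\<^sub>M I (\<lambda>_. S)) (\<lambda>u. good_box L A C u v)"
proof -
  have mem: "Measurable.pred (Pi\<^sub>M I (\<lambda>_. S)) (\<lambda>u. u z \<in> B)" if "z \<in> lattice_box L v" "B \<in> sets S" for z B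
  proof -
    have "(\<lambda>u. u z) \<in> Pi\<^sub>M I (\<lambda>_. S) \<rightarrow>\<^sub>M S"
      using that \<open>lattice_box L v \<subseteq> I\<close> by (intro measurable_component_singleton) auto
    then show ?thesis using that(2) by (rule pred_sets2[rotated])
  qed
  show ?thesis
    unfolding good_box_def
    by (intro pred_intros_logic pred_intros_finite mem finite_lattice_box A C \<open>L > 0\<close>)
qed

text \<open>
  In a large box \<open>A\<close> is missed with small probability; for the given size of the box \<open>C\<close> can then be
  chosen so likely that it holds at all sites.
\<close>

lemma prob_bad_box_le:
  fixes S :: "'s measure" and v :: "int ^ 'd::finite"
  assumes S: "prob_space S" and A: "A \<in> sets S" and C: "C \<in> sets S" and "L > 0"
  shows "measure (iid_field S) {u \<in> space (iid_field S). \<not> good_box L A C u v} \<le>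
    (1 - measure S A) ^ L + real (L ^ CARD('d)) * (1 - measure S C)"
proof -
  interpret S: prob_space S by fact
  interpret P: product_prob_space "\<lambda>_. S" "UNIV :: (int ^ 'd) set" ..
  let ?P = "iid_field S :: (int ^ 'd \<Rightarrow> 's) measure"
  have coord: "{u \<in> space ?P. \<forall>z\<in>J. u z \<in> X} = P.emb UNIV J (Pi\<^sub>E J (\<lambda>_. X))"
    if "X \<in> sets S" for J X
    using sets.sets_into_space[OF that] by (auto simp: prod_emb_def space_PiM PiE_iff)
  have meas: "P.prob {u \<in> space ?P. \<forall>z\<in>J. u z \<in> X} = measure S X ^ card J"
    if "X \<in> sets S" "finite J" for J X
    using P.measure_PiM_emb[of J "\<lambda>_. X"] that by (simp add: coord)
  have sets: "{u \<in> space ?P. \<forall>z\<in>J. u z \<in> X} \<in> sets ?P" if "X \<in> sets S" "finite J" for J X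
    unfolding coord[OF that(1)] using that by (intro sets_PiM_I) auto
  have mC: "measure S (space S - C) = 1 - measure S C"
    and mA: "measure S (space S - A) = 1 - measure S A"
    using A C by (auto simp: S.prob_compl)
  let ?E = "{u \<in> space ?P. \<forall>z\<in>lattice_box L v. u z \<in> space S - A}"
  let ?F = "\<lambda>z. {u \<in> space ?P. \<forall>z\<in>{z}. u z \<in> space S - C}"
  have sub: "{u \<in> space ?P. \<not> good_box L A C u v} \<subseteq> ?E \<union> (\<Union>z\<in>lattice_box L v. ?F z)"
    by (auto simp: good_box_def space_PiM)
  have setsF: "(\<Union>z\<in>lattice_box L v. ?F z) \<in> sets ?P"
    using C finite_lattice_box[OF \<open>L > 0\<close>] by (intro sets.finite_UN sets) auto
  have setsE: "?E \<in> sets ?P"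
    using A finite_lattice_box[OF \<open>L > 0\<close>] by (intro sets) auto
  have "P.prob {u \<in> space ?P. \<not> good_box L A C u v} \<le> P.prob (?E \<union> (\<Union>z\<in>lattice_box L v. ?F z))"
    using setsE setsF by (intro P.finite_measure_mono sub) auto
  also have "\<dots> \<le> P.prob ?E + P.prob (\<Union>z\<in>lattice_box L v. ?F z)"
    using setsE setsF by (rule measure_Un_le)
  also have "P.prob ?E = (1 - measure S A) ^ card (lattice_box L v)"
    using A finite_lattice_box[OF \<open>L > 0\<close>] by (subst meas) (auto simp: mA)
  also have "\<dots> \<le> (1 - measure S A) ^ L"
    using \<open>L > 0\<close> by (intro power_decreasing) (auto simp: card_lattice_box intro!: self_le_power)
  also have "P.prob (\<Union>z\<in>lattice_box L v. ?F z) \<le> (\<Sum>z\<in>lattice_box L v. P.prob (?F z))"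
    using C finite_lattice_box[OF \<open>L > 0\<close>]
    by (intro P.finite_measure_subadditive_finite image_subsetI sets) auto
  also have "(\<Sum>z\<in>lattice_box L v. P.prob (?F z)) = real (L ^ CARD('d)) * (1 - measure S C)"
    using C by (subst meas) (auto simp: mC card_lattice_box[OF \<open>L > 0\<close>])
  finally show ?thesis by simp
qed

lemma measurable_good_count:
  assumes A: "A \<in> sets S" and C: "C \<in> sets S" and "L > 0"
  shows "Measurable.pred (iid_field S) (\<lambda>u. card {a \<in> set p. good_box L A C u a} < j)"
proof -
  have [measurable]: "Measurable.pred (iid_field S) (\<lambda>u. good_box L A C u v)" for v
    by (rule measurable_good_box[OF A C \<open>L > 0\<close>]) simp
  have "card {a \<in> set p. good_box L A C u a} < j \<longleftrightarrow>
      (\<Sum>a\<in>set p. if good_box L A C u a then 1 else 0 :: real) < real j" for u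
    by (simp add: sum.If_cases Int_def)
  then show ?thesis by simp
qed

text \<open>
  A Chernoff bound: weight each good box by \<open>\<epsilon>\<close>. The product of the independent weights along the
  path has mean at most \<open>(2 \<epsilon>)\<^bsup>2 j\<^esup>\<close>, but it is at least \<open>\<epsilon>\<^bsup>j\<^esup>\<close> when fewer than \<open>j\<close> boxes are good.
\<close>

lemma prob_few_good_boxes:
  fixes S :: "'s measure" and p :: "(int ^ 'd::finite) list"
  assumes S: "prob_space S" and A: "A \<in> sets S" and C: "C \<in> sets S" and "L > 0"
    and \<epsilon>: "0 < \<epsilon>" "\<epsilon> < 1"
    and bad: "\<And>v :: int ^ 'd. measure (iid_field S) {u \<in> space (iid_field S). \<not> good_box L A C u v} \<le> \<epsilon>"
    and p: "distinct p" "length p = 2 * j"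
  shows "measure (iid_field S)
    {u \<in> space (iid_field S). card {a \<in> set p. good_box L A C u a} < j} \<le> (4 * \<epsilon>) ^ j"
proof -
  let ?P = "iid_field S :: (int ^ 'd \<Rightarrow> 's) measure"
  interpret P: prob_space ?P by (intro prob_space_PiM S)
  define X where "X v u = (if good_box L A C u v then \<epsilon> else 1)" for v and u :: "int ^ 'd \<Rightarrow> 's"
  have [measurable]: "Measurable.pred ?P (\<lambda>u. good_box L A C u v)" for v
    by (rule measurable_good_box[OF A C \<open>L > 0\<close>]) simp
  have X_meas [measurable]: "X v \<in> borel_measurable ?P" for v
    unfolding X_def by measurable
  have X_bounds: "0 < X v u" "X v u \<le> 1" for v u
    using \<epsilon> by (auto simp: X_def)
  have X_nonneg: "0 \<le> X v u" for v u
    using X_bounds(1) by (rule less_imp_le)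
  have X_int: "integrable ?P (X v)" for v
    using X_bounds by (intro P.integrable_const_bound[of _ 1]) (auto simp: abs_of_pos)
  have indep: "P.indep_vars (\<lambda>_. borel) X (set p)"
  proof -
    have "P.indep_vars (\<lambda>v. Pi\<^sub>M (lattice_box L v) (\<lambda>_. S)) (\<lambda>v u. restrict u (lattice_box L v)) (set p)"
      using P.indep_vars_restrict[OF indep_vars_coordinates[OF S], of "set p" "lattice_box L"]
      by (auto simp: disjoint_family_on_def lattice_box_def)
    then have "P.indep_vars (\<lambda>_. borel) (\<lambda>v u. X v (restrict u (lattice_box L v))) (set p)"
    proof (rule P.indep_vars_compose2)
      show "X v \<in> borel_measurable (Pi\<^sub>M (lattice_box L v) (\<lambda>_. S))" for v
        unfolding X_def using measurable_good_box[OF A C \<open>L > 0\<close> order_refl]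
        by (intro measurable_If) (auto simp: pred_def)
    qed
    moreover have "X v (restrict u (lattice_box L v)) = X v u" for v u
      by (simp add: X_def good_box_def)
    ultimately show ?thesis by simp
  qed
  have X_exp: "P.expectation (X v) \<le> 2 * \<epsilon>" for v
  proof -
    have "P.expectation (X v) \<le> P.expectation (\<lambda>u. \<epsilon> + indicator {u \<in> space ?P. \<not> good_box L A C u v} u)"
      using \<epsilon> by (intro integral_mono X_int Bochner_Integration.integrable_add
          P.integrable_const integrable_real_indicator) (auto simp: X_def less_top[symmetric])
    also have "\<dots> = \<epsilon> + P.prob {u \<in> space ?P. \<not> good_box L A C u v}"
      by (subst Bochner_Integration.integral_add)
         (auto simp: P.prob_space less_top[symmetric] intro!: integrable_real_indicator)
    finally show ?thesis using bad[of v] by simp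
  qed
  have prod_int: "integrable ?P (\<lambda>u. \<Prod>v\<in>set p. X v u)"
    using indep X_int by (intro P.indep_vars_integrable) auto
  have "card (set p) = 2 * j"
    using p by (simp add: distinct_card)
  have "P.prob {u \<in> space ?P. card {a \<in> set p. good_box L A C u a} < j} \<le>
      P.prob {u \<in> space ?P. \<epsilon> ^ j \<le> (\<Prod>v\<in>set p. X v u)}"
  proof (rule P.finite_measure_mono)
    show "{u \<in> space ?P. card {a \<in> set p. good_box L A C u a} < j} \<subseteq>
      {u \<in> space ?P. \<epsilon> ^ j \<le> (\<Prod>v\<in>set p. X v u)}"
    proof safe
      fix u assume "card {a \<in> set p. good_box L A C u a} < j"
      then have "\<epsilon> ^ j \<le> \<epsilon> ^ card {a \<in> set p. good_box L A C u a}"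
        using \<epsilon> by (intro power_decreasing) auto
      also have "\<dots> = (\<Prod>v\<in>set p. X v u)"
        by (simp add: X_def prod.If_cases Int_def)
      finally show "\<epsilon> ^ j \<le> (\<Prod>v\<in>set p. X v u)" .
    qed
    show "{u \<in> space ?P. \<epsilon> ^ j \<le> (\<Prod>v\<in>set p. X v u)} \<in> P.events"
      by measurable
  qed
  also have "\<dots> \<le> P.expectation (\<lambda>u. \<Prod>v\<in>set p. X v u) / \<epsilon> ^ j"
    using \<epsilon> prod_int
    by (intro integral_Markov_inequality_measure[of _ _ "{}"])
       (auto intro!: AE_I2 prod_nonneg X_nonneg)
  also have "P.expectation (\<lambda>u. \<Prod>v\<in>set p. X v u) = (\<Prod>v\<in>set p. P.expectation (X v))"
    using indep X_int by (intro P.indep_vars_lebesgue_integral) auto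
  also have "\<dots> \<le> (\<Prod>v\<in>set p. 2 * \<epsilon>)"
    using X_exp X_nonneg by (intro prod_mono) (auto intro!: integral_nonneg_AE)
  also have "\<dots> = ((2 * \<epsilon>)\<^sup>2) ^ j"
    using \<open>card (set p) = 2 * j\<close> by (simp add: power_mult)
  also have "(2 * \<epsilon>)\<^sup>2 = (4 * \<epsilon>) * \<epsilon>"
    by (simp add: power2_eq_square)
  also have "\<dots> ^ j = (4 * \<epsilon>) ^ j * \<epsilon> ^ j"
    by (rule power_mult_distrib)
  finally show ?thesis using \<epsilon> by (simp add: divide_right_mono)
qed

definition good_paths :: "nat \<Rightarrow> 's set \<Rightarrow> 's set \<Rightarrow> nat \<Rightarrow> (int ^ 'd::finite \<Rightarrow> 's) \<Rightarrow> bool" where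
  "good_paths L A C j u \<longleftrightarrow>
     (\<forall>p. coarse_path p \<longrightarrow> hd p = 0 \<longrightarrow> length p = 2 * j \<longrightarrow>
        j \<le> card {a \<in> set p. good_box L A C u a})"

text \<open>
  Peierls argument: there are at most \<open>N\<^bsup>2 j\<^esup>\<close> coarse paths with \<open>2 j\<close> vertices, and with bad boxes
  of probability \<open>1 / (8 N\<^sup>2)\<close> each of them fails with probability at most \<open>(1 / (2 N\<^sup>2))\<^bsup>j\<^esup>\<close>.
\<close>

lemma prob_not_good_paths:
  fixes S :: "'s measure"
  defines "N \<equiv> real (card (steps :: (int ^ 'd::finite) set))"
  assumes S: "prob_space S" and A: "A \<in> sets S" and C: "C \<in> sets S" and "L > 0"
    and bad: "\<And>v :: int ^ 'd. measure (iid_field S) {u \<in> space (iid_field S). \<not> good_box L A C u v} \<le> 1 / (8 * N\<^sup>2)"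
  shows "{u \<in> space (iid_field S :: (int ^ 'd \<Rightarrow> 's) measure). \<not> good_paths L A C j u} \<in> sets (iid_field S)"
    and "measure (iid_field S) {u \<in> space (iid_field S :: (int ^ 'd \<Rightarrow> 's) measure). \<not> good_paths L A C j u} \<le> (1 / 2) ^ j"
proof -
  let ?P = "iid_field S :: (int ^ 'd \<Rightarrow> 's) measure"
  interpret P: prob_space ?P by (intro prob_space_PiM S)
  let ?Q = "{p :: (int ^ 'd) list. coarse_path p \<and> hd p = 0 \<and> length p = 2 * j}"
  let ?E = "\<lambda>p. {u \<in> space ?P. card {a \<in> set p. good_box L A C u a} < j}"
  have N: "N \<ge> 1"
    using card_steps_pos[where 'd = 'd] by (simp add: N_def)
  have E_sets: "?E p \<in> sets ?P" for p
    using measurable_good_count[OF A C \<open>L > 0\<close>] by (rule predE)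
  have eq: "{u \<in> space ?P. \<not> good_paths L A C j u} = (\<Union>p\<in>?Q. ?E p)"
    by (auto simp: good_paths_def not_le)
  show "{u \<in> space ?P. \<not> good_paths L A C j u} \<in> sets ?P"
    unfolding eq using E_sets finite_coarse_paths by (intro sets.finite_UN) auto
  have "P.prob {u \<in> space ?P. \<not> good_paths L A C j u} \<le> (\<Sum>p\<in>?Q. P.prob (?E p))"
    unfolding eq using E_sets finite_coarse_paths
    by (intro P.finite_measure_subadditive_finite) auto
  also have "\<dots> \<le> (\<Sum>p\<in>?Q. (4 * (1 / (8 * N\<^sup>2))) ^ j)"
  proof (intro sum_mono prob_few_good_boxes S A C \<open>L > 0\<close> bad)
    show "0 < 1 / (8 * N\<^sup>2)" using N by simp
    show "1 / (8 * N\<^sup>2) < 1"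
    proof -
      have "1 < 8 * N\<^sup>2" using one_le_power[OF N, of 2] by linarith
      then show ?thesis by (subst divide_less_eq_1_pos) auto
    qed
  qed (auto simp: coarse_path_def)
  also have "\<dots> = real (card ?Q) * (1 / (2 * N\<^sup>2)) ^ j"
    by simp
  also have "\<dots> \<le> N ^ (2 * j) * (1 / (2 * N\<^sup>2)) ^ j"
    using card_coarse_paths[of "0 :: int ^ 'd" "2 * j"] 
    by (intro mult_right_mono) (auto simp: N_def simp flip: of_nat_power)
  also have "\<dots> = (N\<^sup>2 * (1 / (2 * N\<^sup>2))) ^ j"
    by (simp only: power_mult power_mult_distrib)
  also have "N\<^sup>2 * (1 / (2 * N\<^sup>2)) = 1 / 2"
    using N by simp
  finally show "P.prob {u \<in> space ?P. \<not> good_paths L A C j u} \<le> (1 / 2) ^ j" .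
qed

section \<open>Monotone coupling through quantile functions\<close>

definition unif :: "real measure" where
  "unif = restrict_space lborel {0<..<1}"

text \<open>
  The generalised inverse of \<open>F\<close>: applied to a uniform variable it has distribution function \<open>F\<close>,
  and it reverses the pointwise order of distribution functions.
\<close>

definition quantile :: "(real \<Rightarrow> real) \<Rightarrow> real \<Rightarrow> real" where
  "quantile F u = Inf {x. u \<le> F x}"

lemma prob_space_unif: "prob_space unif"
  by (auto simp: unif_def emeasure_restrict_space space_restrict_space intro!: prob_spaceI)

lemma space_unif [simp]: "space unif = {0<..<1}"
  by (simp add: unif_def space_restrict_space)

lemma interval_in_sets_unif:
  assumes "0 \<le> a" "b \<le> 1"
  shows "{a<..<b} \<in> sets unif"
  using assms by (auto simp: unif_def sets_restrict_space_iff)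

lemma measure_unif_interval:
  assumes "0 \<le> a" "a \<le> b" "b \<le> 1"
  shows "measure unif {a<..<b} = b - a"
proof -
  have "{a<..<b} \<subseteq> {0<..<1}" using assms by auto
  then show ?thesis
    using assms by (simp add: unif_def measure_restrict_space)
qed

context
  fixes F :: "real \<Rightarrow> real"
  assumes F: "distribution_function F"
begin

lemma distribution_function_at_bot: "(F \<longlongrightarrow> 0) at_bot"
proof (rule tendsto_eventually)
  show "\<forall>\<^sub>F t in at_bot. F t = 0"
    using F unfolding distribution_function_def eventually_at_bot_linorder
    by (intro exI[of _ "- 1"]) auto
qed

lemma cdf_distribution_interval_measure: "cdf_distribution (interval_measure F)"
  and cdf_interval_measure_eq: "cdf (interval_measure F) = F"
  using F distribution_function_at_bot unfolding cdf_distribution_def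
  by (auto intro!: real_distribution_interval_measure cdf_interval_measure
      simp: distribution_function_def mono_def)

lemma distribution_function_bounds: "0 \<le> F t" "F t \<le> 1"
proof -
  interpret cdf_distribution "interval_measure F"
    by (rule cdf_distribution_interval_measure)
  show "0 \<le> F t" "F t \<le> 1"
    using cdf_nonneg[of t] cdf_bounded_prob[of t] by (simp_all add: cdf_interval_measure_eq)
qed

lemma quantile_le_iff:
  assumes "0 < u" "u < 1"
  shows "quantile F u \<le> x \<longleftrightarrow> u \<le> F x"
proof -
  interpret cdf_distribution "interval_measure F"
    by (rule cdf_distribution_interval_measure)
  show ?thesis
    using pseudoinverse[OF assms, of x] by (simp add: quantile_def cdf_interval_measure_eq)
qed

lemma le_at_quantile: "0 < u \<Longrightarrow> u < 1 \<Longrightarrow> u \<le> F (quantile F u)"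
  using quantile_le_iff by blast

lemma quantile_nonneg:
  assumes "0 < u" "u < 1"
  shows "0 \<le> quantile F u"
proof (rule ccontr)
  assume "\<not> 0 \<le> quantile F u"
  then have "F (quantile F u) = 0"
    using F by (simp add: distribution_function_def)
  then show False
    using le_at_quantile[OF assms] assms by simp
qed

lemma quantile_mono:
  assumes "0 < u" "u \<le> v" "v < 1"
  shows "quantile F u \<le> quantile F v"
  using le_at_quantile[of v] assms by (subst quantile_le_iff) auto

lemma quantile_measurable: "quantile F \<in> unif \<rightarrow>\<^sub>M borel"
proof -
  interpret cdf_distribution "interval_measure F"
    by (rule cdf_distribution_interval_measure)
  have "quantile F = I"
    by (simp add: fun_eq_iff quantile_def cdf_interval_measure_eq)
  moreover have "sets unif = sets (restrict_space borel {0<..<1})"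
    unfolding unif_def by (rule sets_restrict_space_cong) simp
  ultimately show ?thesis
    using measurable_CI by (simp cong: measurable_cong_sets)
qed

lemma distr_quantile: "distr unif borel (quantile F) = interval_measure F"
proof -
  interpret cdf_distribution "interval_measure F"
    by (rule cdf_distribution_interval_measure)
  have "quantile F = I"
    by (simp add: fun_eq_iff quantile_def cdf_interval_measure_eq)
  then show ?thesis
    using distr_I_eq_M by (simp add: unif_def)
qed

lemma quantile_field_measurable:
  "(\<lambda>u x. quantile F (u x)) \<in> iid_field unif \<rightarrow>\<^sub>M Pi\<^sub>M UNIV (\<lambda>_. borel)"
proof (rule measurable_PiM_single')
  show "(\<lambda>u. quantile F (u x)) \<in> iid_field unif \<rightarrow>\<^sub>M borel" for x
    using quantile_measurable by (rule measurable_compose[rotated]) simp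
qed (simp add: space_PiM)

lemma distr_quantile_field:
  "distr (iid_field unif) (Pi\<^sub>M UNIV (\<lambda>_. borel)) (\<lambda>u (x :: int ^ 'd::finite). quantile F (u x)) =
    potential_law F"
proof -
  interpret P: prob_space "iid_field unif :: (int ^ 'd \<Rightarrow> real) measure"
    by (intro prob_space_PiM prob_space_unif)
  have coord: "(\<lambda>u. u x) \<in> iid_field unif \<rightarrow>\<^sub>M unif" for x :: "int ^ 'd"
    by (rule measurable_component_singleton) simp
  have meas: "(\<lambda>u. quantile F (u x)) \<in> iid_field unif \<rightarrow>\<^sub>M borel" for x :: "int ^ 'd"
    by (rule measurable_compose[OF coord quantile_measurable])
  have "P.indep_vars (\<lambda>_. borel) (\<lambda>(x :: int ^ 'd) u. quantile F (u x)) UNIV"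
    using indep_vars_coordinates[OF prob_space_unif] quantile_measurable
    by (rule P.indep_vars_compose2)
  then have "distr (iid_field unif) (Pi\<^sub>M UNIV (\<lambda>_. borel)) (\<lambda>u. \<lambda>x\<in>(UNIV :: (int ^ 'd) set). quantile F (u x)) =
      Pi\<^sub>M UNIV (\<lambda>x. distr (iid_field unif) borel (\<lambda>u. quantile F (u x)))"
    by (subst (asm) P.indep_vars_iff_distr_eq_PiM) (auto intro: meas)
  moreover have "distr (iid_field unif) borel (\<lambda>u. quantile F (u x)) = interval_measure F" for x :: "int ^ 'd"
  proof -
    have "distr (iid_field unif) borel (\<lambda>u. quantile F (u x)) =
        distr (distr (iid_field unif) unif (\<lambda>u. u x)) borel (quantile F)"
      by (subst distr_distr[OF quantile_measurable coord]) (simp add: comp_def)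
    also have "distr (iid_field unif) unif (\<lambda>u. u x) = unif"
      by (rule distr_PiM_component) (auto intro: prob_space_unif)
    finally show ?thesis by (simp add: distr_quantile)
  qed
  ultimately show ?thesis
    by (simp add: potential_law_def restrict_UNIV)
qed

text \<open>
  Convergence in probability depends only on the law of the potential, so it can be read on the
  common probability space on which the potentials of all distribution functions are defined.
\<close>

lemma tendsto_in_prob_quantile:
  fixes X :: "nat \<Rightarrow> (int ^ 'd::finite \<Rightarrow> real) \<Rightarrow> real"
  assumes X: "tendsto_in_prob (potential_law F) X l" and "\<epsilon> > 0"
  shows "{u \<in> space (iid_field unif). \<epsilon> < \<bar>X n (\<lambda>x. quantile F (u x)) - l\<bar>} \<in> sets (iid_field unif)"
    and "(\<lambda>n. measure (iid_field unif)
      {u \<in> space (iid_field unif). \<epsilon> < \<bar>X n (\<lambda>x. quantile F (u x)) - l\<bar>}) \<longlonglongrightarrow> 0"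
proof -
  let ?q = "\<lambda>u (x :: int ^ 'd). quantile F (u x)"
  let ?B = "\<lambda>n. {\<omega> \<in> space (potential_law F). \<epsilon> < \<bar>X n \<omega> - l\<bar>}"
  have sets_law: "sets (potential_law F) = sets (Pi\<^sub>M UNIV (\<lambda>_ :: int ^ 'd. borel))"
    by (simp add: distr_quantile_field[symmetric])
  have q: "?q \<in> iid_field unif \<rightarrow>\<^sub>M Pi\<^sub>M UNIV (\<lambda>_. borel)"
    by (rule quantile_field_measurable)
  have B: "?B n \<in> sets (potential_law F)" for n
  proof -
    have [measurable]: "X n \<in> borel_measurable (potential_law F)"
      using X by (simp add: tendsto_in_prob_def)
    show ?thesis by measurable
  qed
  have vimage: "{u \<in> space (iid_field unif). \<epsilon> < \<bar>X n (?q u) - l\<bar>} = ?q -` ?B n \<inter> space (iid_field unif)" for n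
    using sets_eq_imp_space_eq[OF sets_law] by (auto simp: space_PiM)
  show "{u \<in> space (iid_field unif). \<epsilon> < \<bar>X n (?q u) - l\<bar>} \<in> sets (iid_field unif)"
    unfolding vimage using B[of n] by (intro measurable_sets[OF q]) (simp add: sets_law)
  have "measure (iid_field unif) {u \<in> space (iid_field unif). \<epsilon> < \<bar>X n (?q u) - l\<bar>} =
      measure (potential_law F) (?B n)" for n
    unfolding vimage using B[of n]
    by (subst measure_distr[OF q, symmetric]) (simp_all add: sets_law distr_quantile_field)
  then show "(\<lambda>n. measure (iid_field unif)
      {u \<in> space (iid_field unif). \<epsilon> < \<bar>X n (?q u) - l\<bar>}) \<longlonglongrightarrow> 0"
    using X \<open>\<epsilon> > 0\<close> by (simp add: tendsto_in_prob_def)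
qed

end

lemma quantile_antimono:
  assumes "distribution_function F" "distribution_function G" "strictly_dominates F G"
    and u: "0 < u" "u < 1"
  shows "quantile G u \<le> quantile F u"
proof -
  have "u \<le> F (quantile F u)"
    by (rule le_at_quantile[OF assms(1) u])
  also have "\<dots> \<le> G (quantile F u)"
    using assms(3) quantile_nonneg[OF assms(1) u] by (simp add: strictly_dominates_def)
  finally show ?thesis
    by (simp add: quantile_le_iff[OF assms(2) u])
qed

text \<open>
  If \<open>F t < G t\<close>, right-continuity gives some \<open>s > t\<close> with \<open>F s < G t\<close>. Levels in between are
  reached by \<open>G\<close> no later than \<open>t\<close> and by \<open>F\<close> only after \<open>s\<close>.
\<close>

lemma quantile_gap:
  assumes F: "distribution_function F" and G: "distribution_function G" and "strictly_dominates F G"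
  obtains a b \<delta> where "0 \<le> a" "a < b" "b \<le> 1" "0 < \<delta>"
    "\<And>u. u \<in> {a<..<b} \<Longrightarrow> quantile G u + \<delta> \<le> quantile F u"
proof -
  obtain t where t: "F t < G t"
    using assms(3) unfolding strictly_dominates_def by (metis order_le_imp_less_or_eq)
  have "(F \<longlongrightarrow> F t) (at_right t)"
    using F by (simp add: distribution_function_def continuous_within)
  then have "\<forall>\<^sub>F s in at_right t. F s < G t"
    by (rule order_tendstoD(2)) (rule t)
  moreover have "\<forall>\<^sub>F s in at_right t. t < s"
    by (rule eventually_at_right_less)
  ultimately have "\<forall>\<^sub>F s in at_right t. t < s \<and> F s < G t"
    by eventually_elim simp
  then obtain s where s: "t < s" "F s < G t"
    using eventually_happens'[OF trivial_limit_at_right_real] by blast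
  show ?thesis
  proof (rule that[of "F s" "G t" "s - t"])
    fix u assume u: "u \<in> {F s<..<G t}"
    then have u01: "0 < u" "u < 1"
      using distribution_function_bounds(1)[OF F, of s] distribution_function_bounds(2)[OF G, of t]
      by auto
    have "quantile G u \<le> t"
      using u by (simp add: quantile_le_iff[OF G u01])
    moreover have "\<not> quantile F u \<le> s"
      using u by (simp add: quantile_le_iff[OF F u01])
    ultimately show "quantile G u + (s - t) \<le> quantile F u"
      by simp
  qed (use s distribution_function_bounds(1)[OF F] distribution_function_bounds(2)[OF G] in auto)
qed

section \<open>The gap on the lattice\<close>

definition lattice_l1 :: "int ^ 'd::finite \<Rightarrow> real" where
  "lattice_l1 x = (\<Sum>i\<in>UNIV. \<bar>real_of_int (x $ i)\<bar>)"

lemma abs_div_ge: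
  fixes a :: int
  assumes "L > 0"
  shows "\<bar>real_of_int a\<bar> / real L - 1 \<le> \<bar>real_of_int (a div int L)\<bar>"
proof -
  have a: "real_of_int a / real L = real_of_int (a div int L) + real_of_int (a mod int L) / real L"
  proof -
    have "real_of_int a = real_of_int (a div int L * int L + a mod int L)"
      by simp
    also have "\<dots> = real_of_int (a div int L) * real L + real_of_int (a mod int L)"
      by (simp only: of_int_add of_int_mult of_int_of_nat_eq)
    finally show ?thesis using assms by (simp add: field_simps)
  qed
  have "0 \<le> real_of_int (a mod int L) / real L" "real_of_int (a mod int L) / real L \<le> 1"
  proof -
    have "0 \<le> a mod int L" "a mod int L < int L" using assms by simp_all
    then have "0 \<le> real_of_int (a mod int L)" "real_of_int (a mod int L) \<le> real L" by linarith+
    then show "0 \<le> real_of_int (a mod int L) / real L" "real_of_int (a mod int L) / real L \<le> 1"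
      using assms by (simp_all add: field_simps)
  qed
  moreover have "\<bar>real_of_int a\<bar> / real L = \<bar>real_of_int a / real L\<bar>"
    by simp
  ultimately show ?thesis
    unfolding a by linarith
qed

text \<open>
  Rounding down to multiples of \<open>L\<close> costs at most one box per coordinate.
\<close>

lemma coarse_distance_ge:
  fixes x :: "int ^ 'd::finite"
  assumes "L > 0"
  shows "real n * lattice_l1 x / real L - CARD('d) \<le>
    real (site_dist (box_index L 0) (box_index L (int n *s x)))"
proof -
  have "real n * lattice_l1 x / real L - CARD('d) =
      (\<Sum>i\<in>UNIV. \<bar>real_of_int (int n * x $ i)\<bar> / real L - 1)"
    by (simp add: lattice_l1_def sum_subtractf sum_distrib_left sum_divide_distrib abs_mult)
  also have "\<dots> \<le> (\<Sum>i\<in>UNIV. \<bar>real_of_int ((int n * x $ i) div int L)\<bar>)"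
    by (intro sum_mono abs_div_ge assms)
  also have "\<dots> = real (site_dist (box_index L 0) (box_index L (int n *s x)))"
    by (simp add: site_dist_def box_index_def)
  finally show ?thesis .
qed

text \<open>
  The comparison of travel weights, applied with the first-passage distance to the box of \<open>y\<close> as \<open>T\<close>.
\<close>

lemma travel_cost_gap:
  fixes u :: "int ^ 'd::finite \<Rightarrow> real" and F G :: "real \<Rightarrow> real" and \<beta> \<delta> :: real and L :: nat
  defines "N \<equiv> real (card (steps :: (int ^ 'd) set))"
  defines "\<gamma> \<equiv>
    min (\<delta> / 2) ((1 - exp (- \<delta> / 2)) * (exp (- 2 * quantile G \<beta>) / (2 * N\<^sup>2)) ^ (CARD('d) * L))"
  assumes F: "distribution_function F" and G: "distribution_function G"
    and dom: "strictly_dominates F G"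
    and gap: "\<And>t. t \<in> A \<Longrightarrow> quantile G t + \<delta> \<le> quantile F t"
    and "L > 0" "\<delta> > 0" and \<beta>: "0 < \<beta>" "\<beta> < 1"
    and u: "\<And>z. 0 < u z" "\<And>z. u z < 1"
    and good: "good_paths L A {0<..<\<beta>} j u"
    and j: "2 * j \<le> site_dist (box_index L 0) (box_index L y)"
  shows "travel_cost 0 y (\<lambda>z. quantile G (u z)) + \<gamma> * j - \<delta> / 2 \<le>
    travel_cost 0 y (\<lambda>z. quantile F (u z))"
proof -
  let ?\<omega>F = "\<lambda>z. quantile F (u z)" and ?\<omega>G = "\<lambda>z. quantile G (u z)"
  let ?good = "good_box L A {0<..<\<beta>} u"
  define T where "T x = real (good_count ?good (box_index L y) (box_index L x))" for x
  have le: "?\<omega>G z \<le> ?\<omega>F z" for z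
    by (rule quantile_antimono[OF F G dom u])
  have nonneg: "0 \<le> ?\<omega>G z" "0 \<le> ?\<omega>F z" for z
    using quantile_nonneg[OF F u] quantile_nonneg[OF G u] by auto
  have \<gamma>: "0 \<le> \<gamma>"
    using \<open>\<delta> > 0\<close> by (simp add: \<gamma>_def)
  have T0: "real j \<le> T 0"
  proof (cases "j = 0")
    case False
    have b0: "box_index L 0 = (0 :: int ^ 'd)"
      by (simp add: box_index_def vec_eq_iff)
    have "j \<le> good_count ?good (box_index L y) (box_index L 0)"
    proof (rule good_count_ge[OF _ j])
      show "j \<le> card {a \<in> set p. ?good a}"
        if "coarse_path p" "hd p = box_index L 0" "length p = 2 * j" for p
        using good that by (simp add: good_paths_def b0)
    qed (use False in simp)
    then show ?thesis by (simp add: T_def)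
  qed (simp add: T_def)
  have "travel_weight 0 y ?\<omega>F \<le> exp (\<delta> / 2) * exp (- \<gamma> * T 0) * travel_weight 0 y ?\<omega>G"
    unfolding \<gamma>_def N_def
  proof (rule travel_weight_box_comparison[where good = ?good])
    show "0 \<le> quantile G \<beta>" by (rule quantile_nonneg[OF G \<beta>])
    show "\<exists>z. box_index L z = v \<and> ?\<omega>G z + \<delta> \<le> ?\<omega>F z" if "?good v" for v
      using that gap by (auto simp: good_box_def lattice_box_def)
    show "?\<omega>G x \<le> quantile G \<beta>" if "?good (box_index L x)" for x
    proof -
      have "u x \<in> {0<..<\<beta>}" using that by (auto simp: good_box_def lattice_box_def)
      then show ?thesis using \<beta> by (intro quantile_mono[OF G]) auto
    qed
    show "T x \<le> of_bool (?good (box_index L x)) + T (x + e)" if "e \<in> steps" for x e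
    proof -
      have "T x \<le> real (of_bool (?good (box_index L x)) +
          good_count ?good (box_index L y) (box_index L (x + e)))"
        unfolding T_def of_nat_le_iff by (rule good_count_box_step[OF \<open>L > 0\<close> that])
      then show ?thesis by (simp add: T_def)
    qed
  qed (use nonneg le \<open>L > 0\<close> \<open>\<delta> > 0\<close> in \<open>auto simp: T_def good_count_self\<close>)
  also have "exp (\<delta> / 2) * exp (- \<gamma> * T 0) = exp (\<delta> / 2 - \<gamma> * T 0)"
    by (simp add: exp_add[symmetric])
  finally have "ln (travel_weight 0 y ?\<omega>F) \<le> ln (exp (\<delta> / 2 - \<gamma> * T 0) * travel_weight 0 y ?\<omega>G)"
    by (rule ln_mono) (rule travel_weight_pos[OF nonneg(2)])
  also have "\<dots> = \<delta> / 2 - \<gamma> * T 0 + ln (travel_weight 0 y ?\<omega>G)"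
    using travel_weight_pos[of ?\<omega>G 0 y] nonneg by (subst ln_mult) auto
  finally have "travel_cost 0 y ?\<omega>G + \<gamma> * T 0 - \<delta> / 2 \<le> travel_cost 0 y ?\<omega>F"
    unfolding travel_cost_def by linarith
  moreover have "\<gamma> * j \<le> \<gamma> * T 0"
    by (rule mult_left_mono[OF T0 \<gamma>])
  ultimately show ?thesis by linarith
qed

lemma exists_box_parameters:
  fixes p \<epsilon> :: real
  assumes "0 < p" "p \<le> 1" "\<epsilon> > 0"
  obtains L \<beta> where "L > 0" "0 < \<beta>" "\<beta> < 1" "(1 - p) ^ L + real (L ^ d) * (1 - \<beta>) \<le> \<epsilon>"
proof -
  have "(\<lambda>L. (1 - p) ^ L) \<longlonglongrightarrow> 0"
    using assms by (intro LIMSEQ_realpow_zero) auto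
  then have "\<forall>\<^sub>F L in sequentially. (1 - p) ^ L < \<epsilon> / 2"
    using \<open>\<epsilon> > 0\<close> by (intro order_tendstoD) auto
  then have "\<forall>\<^sub>F L in sequentially. L > 0 \<and> (1 - p) ^ L < \<epsilon> / 2"
    using eventually_gt_at_top[of 0] by eventually_elim simp
  then obtain L where L: "L > 0" "(1 - p) ^ L < \<epsilon> / 2"
    using eventually_happens'[OF trivial_limit_sequentially] by blast
  define \<beta> where "\<beta> = max (1 / 2) (1 - \<epsilon> / (2 * real (L ^ d)))"
  have "real (L ^ d) > 0" using L by simp
  moreover have "1 - \<beta> \<le> \<epsilon> / (2 * real (L ^ d))"
    by (simp add: \<beta>_def)
  ultimately have "real (L ^ d) * (1 - \<beta>) \<le> \<epsilon> / 2"
    by (simp add: field_simps)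
  moreover have "0 < \<beta>" "\<beta> < 1"
    using \<open>\<epsilon> > 0\<close> \<open>real (L ^ d) > 0\<close> by (auto simp: \<beta>_def)
  ultimately show ?thesis
    using L by (intro that) auto
qed

lemma seminorm_zero: "seminorm p \<Longrightarrow> p 0 = 0"
  unfolding seminorm_def by (metis abs_zero mult_zero_left scaleR_zero_left)

text \<open>
  On the common probability space each of three events has probability tending to \<open>0\<close>: that the
  normalised cost for \<open>F\<close> or the one for \<open>G\<close> is far from its limit, or that some coarse path meets few good
  boxes. For large \<open>n\<close> some environment therefore avoids all three, and there the deterministic gap between the two
  costs, divided by \<open>n\<close>, passes to the limits.
\<close>

lemma lattice_gap:
  fixes \<alpha>F \<alpha>G :: "real ^ 'd::finite \<Rightarrow> real"
  assumes F: "distribution_function F" and G: "distribution_function G"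
    and dom: "strictly_dominates F G"
    and \<alpha>F: "quenched_lyapunov_exponent F \<alpha>F" and \<alpha>G: "quenched_lyapunov_exponent G \<alpha>G"
  obtains c where "c > 0"
    "\<And>x :: int ^ 'd. c * lattice_l1 x \<le> \<alpha>F (\<chi> i. real_of_int (x $ i)) - \<alpha>G (\<chi> i. real_of_int (x $ i))"
proof -
  let ?P = "iid_field unif :: (int ^ 'd \<Rightarrow> real) measure"
  interpret P: prob_space ?P by (intro prob_space_PiM prob_space_unif)
  define N where "N = real (card (steps :: (int ^ 'd) set))"
  have N: "N > 0" unfolding N_def by (rule card_steps_pos)
  obtain a b \<delta> where ab: "0 \<le> a" "a < b" "b \<le> 1" and "\<delta> > 0"
    and gap: "\<And>u. u \<in> {a<..<b} \<Longrightarrow> quantile G u + \<delta> \<le> quantile F u"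
    using quantile_gap[OF F G dom] by blast
  obtain L \<beta> where "L > 0" and \<beta>: "0 < \<beta>" "\<beta> < 1"
    and L_\<beta>: "(1 - (b - a)) ^ L + real (L ^ CARD('d)) * (1 - \<beta>) \<le> 1 / (8 * N\<^sup>2)"
    using exists_box_parameters[of "b - a" "1 / (8 * N\<^sup>2)" "CARD('d)"] ab N by auto
  define \<gamma> where "\<gamma> =
    min (\<delta> / 2) ((1 - exp (- \<delta> / 2)) * (exp (- 2 * quantile G \<beta>) / (2 * N\<^sup>2)) ^ (CARD('d) * L))"
  have "\<gamma> > 0"
    using \<open>\<delta> > 0\<close> N by (simp add: \<gamma>_def)
  define bad where "bad j = {u \<in> space ?P. \<not> good_paths L {a<..<b} {0<..<\<beta>} j u}" for j
  have A: "{a<..<b} \<in> sets unif" and C: "{0<..<\<beta>} \<in> sets unif"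
    using ab \<beta> by (auto intro: interval_in_sets_unif)
  have "measure ?P {u \<in> space ?P. \<not> good_box L {a<..<b} {0<..<\<beta>} u v} \<le> 1 / (8 * N\<^sup>2)" for v
    using prob_bad_box_le[OF prob_space_unif A C \<open>L > 0\<close>, of v] L_\<beta> ab \<beta>
    by (simp add: measure_unif_interval)
  note bad = prob_not_good_paths[OF prob_space_unif A C \<open>L > 0\<close> this[unfolded N_def], folded bad_def]
  define c where "c = \<gamma> / (2 * real L)"
  have "c * lattice_l1 x \<le> \<alpha>F (\<chi> i. real_of_int (x $ i)) - \<alpha>G (\<chi> i. real_of_int (x $ i))"
    (is "_ \<le> \<alpha>F ?x - \<alpha>G ?x") for x :: "int ^ 'd"
  proof (cases "x = 0")
    case True
    then have "?x = 0" by (simp add: vec_eq_iff)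
    then show ?thesis
      using \<alpha>F \<alpha>G True
      by (simp add: lattice_l1_def seminorm_zero quenched_lyapunov_exponent_def)
  next
    case False
    have l1_pos: "lattice_l1 x > 0"
    proof -
      obtain i where "x $ i \<noteq> 0" using False by (auto simp: vec_eq_iff)
      then show ?thesis
        unfolding lattice_l1_def by (intro sum_pos2[of _ i]) auto
    qed
    \<comment> \<open>Coarse distance to be covered; the travel cost gap is used with half of it, rounded down,
      because the paths in question have an even number of vertices.\<close>
    define m where "m n = site_dist (box_index L 0) (box_index L (int n *s x))" for n
    define j where "j n = m n div 2" for n
    define K where "K = \<gamma> * (CARD('d) + 1) / 2 + \<delta> / 2"
    have j_ge: "real n * lattice_l1 x / (2 * real L) - (CARD('d) + 1) / 2 \<le> real (j n)" for n
    proof -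
      have "m n \<le> 2 * j n + 1" by (simp add: j_def)
      then have "real (m n) \<le> 2 * real (j n) + 1" by linarith
      moreover have "real n * lattice_l1 x / real L - CARD('d) \<le> real (m n)"
        unfolding m_def by (rule coarse_distance_ge[OF \<open>L > 0\<close>])
      ultimately have "real n * lattice_l1 x / real L - CARD('d) - 1 \<le> real (j n) * 2"
        by linarith
      then have "(real n * lattice_l1 x / real L - CARD('d) - 1) / 2 \<le> real (j n)"
        by (subst pos_divide_le_eq) simp_all
      moreover have "(real n * lattice_l1 x / real L - CARD('d) - 1) / 2 =
          real n * lattice_l1 x / (2 * real L) - (CARD('d) + 1) / 2"
        by (simp add: diff_divide_distrib add_divide_distrib)
      ultimately show ?thesis by simp
    qed
    have j_lim: "filterlim j at_top sequentially"
    proof -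
      have "filterlim (\<lambda>n. real n * (lattice_l1 x / (2 * real L)) - (CARD('d) + 1) / 2) at_top sequentially"
        using l1_pos \<open>L > 0\<close> by real_asymp
      then have "filterlim (\<lambda>n. real (j n)) at_top sequentially"
        by (rule filterlim_at_top_mono) (use j_ge in \<open>auto simp: mult.commute\<close>)
      then show ?thesis
        by (simp add: filterlim_sequentially_iff_filterlim_real)
    qed
    have bad_lim: "(\<lambda>n. P.prob (bad (j n))) \<longlonglongrightarrow> 0"
    proof (rule tendsto_sandwich[of "\<lambda>_. 0" _ _ "\<lambda>n. (1 / 2) ^ j n"])
      have "(\<lambda>k. (1 / 2 :: real) ^ k) \<longlonglongrightarrow> 0"
        by (rule LIMSEQ_realpow_zero) auto
      then show "(\<lambda>n. (1 / 2 :: real) ^ j n) \<longlonglongrightarrow> 0"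
        by (rule filterlim_compose[OF _ j_lim])
    qed (use bad(2) in auto)
    show ?thesis
    proof (rule field_le_epsilon)
      fix \<epsilon> :: real assume "\<epsilon> > 0"
      define \<epsilon>' where "\<epsilon>' = \<epsilon> / 3"
      have "\<epsilon>' > 0" using \<open>\<epsilon> > 0\<close> by (simp add: \<epsilon>'_def)
      let ?a = "\<lambda>H n u. travel_cost 0 (int n *s x) (\<lambda>z. quantile H (u z)) / real n"
      let ?E = "\<lambda>H \<alpha> n. {u \<in> space ?P. \<epsilon>' < \<bar>?a H n u - \<alpha> ?x\<bar>}"
      have "tendsto_in_prob (potential_law F) (\<lambda>n \<omega>. travel_cost 0 (int n *s x) \<omega> / real n) (\<alpha>F ?x)"
        "tendsto_in_prob (potential_law G) (\<lambda>n \<omega>. travel_cost 0 (int n *s x) \<omega> / real n) (\<alpha>G ?x)"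
        using \<alpha>F \<alpha>G by (auto simp: quenched_lyapunov_exponent_def)
      note EF = tendsto_in_prob_quantile[OF F this(1) \<open>\<epsilon>' > 0\<close>]
        and EG = tendsto_in_prob_quantile[OF G this(2) \<open>\<epsilon>' > 0\<close>]
      have "(\<lambda>n. P.prob (?E F \<alpha>F n) + P.prob (?E G \<alpha>G n) + P.prob (bad (j n))) \<longlonglongrightarrow> 0 + 0 + 0"
        by (intro tendsto_add EF(2) EG(2) bad_lim)
      then have "\<forall>\<^sub>F n in sequentially. P.prob (?E F \<alpha>F n) + P.prob (?E G \<alpha>G n) + P.prob (bad (j n)) < 1"
        by (rule order_tendstoD) simp
      moreover have "\<forall>\<^sub>F n in sequentially. K / real n < \<epsilon>'"
        by (rule order_tendstoD(2)[OF _ \<open>\<epsilon>' > 0\<close>]) real_asymp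
      ultimately have "\<forall>\<^sub>F n in sequentially. n > 0 \<and> K / real n < \<epsilon>' \<and>
          P.prob (?E F \<alpha>F n) + P.prob (?E G \<alpha>G n) + P.prob (bad (j n)) < 1"
        using eventually_gt_at_top[of 0] by eventually_elim simp
      then obtain n where n: "n > 0" "K / real n < \<epsilon>'"
        "P.prob (?E F \<alpha>F n) + P.prob (?E G \<alpha>G n) + P.prob (bad (j n)) < 1"
        using eventually_happens'[OF trivial_limit_sequentially] by blast
      have "P.prob (?E F \<alpha>F n \<union> ?E G \<alpha>G n \<union> bad (j n)) < 1"
      proof -
        have "P.prob (?E F \<alpha>F n \<union> ?E G \<alpha>G n \<union> bad (j n)) \<le>
            P.prob (?E F \<alpha>F n \<union> ?E G \<alpha>G n) + P.prob (bad (j n))"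
          by (intro measure_Un_le sets.Un EF(1) EG(1) bad(1))
        also have "P.prob (?E F \<alpha>F n \<union> ?E G \<alpha>G n) \<le> P.prob (?E F \<alpha>F n) + P.prob (?E G \<alpha>G n)"
          by (intro measure_Un_le EF(1) EG(1))
        finally show ?thesis using n(3) by simp
      qed
      then have "?E F \<alpha>F n \<union> ?E G \<alpha>G n \<union> bad (j n) \<noteq> space ?P"
        using P.prob_space by auto
      moreover have "?E F \<alpha>F n \<union> ?E G \<alpha>G n \<union> bad (j n) \<subseteq> space ?P"
        by (auto simp: bad_def)
      ultimately obtain u where u: "u \<in> space ?P" and "u \<notin> ?E F \<alpha>F n \<union> ?E G \<alpha>G n \<union> bad (j n)"
        by blast
      then have close: "\<bar>?a F n u - \<alpha>F ?x\<bar> \<le> \<epsilon>'" "\<bar>?a G n u - \<alpha>G ?x\<bar> \<le> \<epsilon>'"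
        and good: "good_paths L {a<..<b} {0<..<\<beta>} (j n) u"
        by (simp_all add: bad_def not_less)
      have u01: "0 < u z" "u z < 1" for z
        using u by (auto simp: space_PiM PiE_iff)
      have "travel_cost 0 (int n *s x) (\<lambda>z. quantile G (u z)) + \<gamma> * j n - \<delta> / 2 \<le>
          travel_cost 0 (int n *s x) (\<lambda>z. quantile F (u z))"
        unfolding \<gamma>_def N_def
        by (rule travel_cost_gap[OF F G dom gap \<open>L > 0\<close> \<open>\<delta> > 0\<close> \<beta> u01 good])
           (auto simp: j_def m_def)
      moreover have "real n * (c * lattice_l1 x) - K \<le> \<gamma> * j n - \<delta> / 2"
        using mult_left_mono[OF j_ge[of n], of \<gamma>] \<open>\<gamma> > 0\<close>
        by (simp add: c_def K_def algebra_simps)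
      ultimately have "travel_cost 0 (int n *s x) (\<lambda>z. quantile G (u z)) + (real n * (c * lattice_l1 x) - K) \<le>
          travel_cost 0 (int n *s x) (\<lambda>z. quantile F (u z))"
        by linarith
      then have "(travel_cost 0 (int n *s x) (\<lambda>z. quantile G (u z)) + (real n * (c * lattice_l1 x) - K)) / real n \<le>
          ?a F n u"
        by (rule divide_right_mono) simp
      then have "?a G n u + (c * lattice_l1 x - K / real n) \<le> ?a F n u"
        using n(1) by (simp add: add_divide_distrib diff_divide_distrib)
      then show "c * lattice_l1 x \<le> \<alpha>F ?x - \<alpha>G ?x + \<epsilon>"
        using close n(2) unfolding \<epsilon>'_def by linarith
    qed
  qed
  moreover have "c > 0"
    using \<open>\<gamma> > 0\<close> \<open>L > 0\<close> by (simp add: c_def)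
  ultimately show ?thesis by (rule that[rotated])
qed

section \<open>From lattice points to all directions\<close>

text \<open>
  Used to compare a seminorm at a point with its value at a nearby lattice point.
\<close>

lemma seminorm_bounded_on_unit_cube:
  fixes p :: "real ^ 'd::finite \<Rightarrow> real"
  assumes p: "seminorm p"
  obtains K where "\<And>w. (\<And>i. \<bar>w $ i\<bar> \<le> 1) \<Longrightarrow> p w \<le> K"
proof -
  have add: "p (x + y) \<le> p x + p y" and scale: "p (r *\<^sub>R x) = \<bar>r\<bar> * p x" for x y r
    using p by (auto simp: seminorm_def)
  have nonneg: "0 \<le> p x" for x
    using add[of x "- x"] scale[of "- 1" x] seminorm_zero[OF p] by simp
  have sum_le: "p (\<Sum>i\<in>I. f i) \<le> (\<Sum>i\<in>I. p (f i))" if "finite I" for I :: "'d set" and f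
    using that
  proof induction
    case (insert i I)
    then show ?case using add[of "f i" "\<Sum>i\<in>I. f i"] by simp
  qed (simp add: seminorm_zero[OF p])
  show ?thesis
  proof (rule that[of "\<Sum>i\<in>UNIV. p (axis i 1)"])
    fix w :: "real ^ 'd" assume w: "\<And>i. \<bar>w $ i\<bar> \<le> 1"
    have "w = (\<Sum>i\<in>UNIV. w $ i *\<^sub>R axis i 1)"
      using basis_expansion[of w] by (simp add: scalar_mult_eq_scaleR)
    then have "p w \<le> (\<Sum>i\<in>UNIV. p (w $ i *\<^sub>R axis i 1))"
      using sum_le[of UNIV "\<lambda>i. w $ i *\<^sub>R axis i 1"] by simp
    also have "\<dots> \<le> (\<Sum>i\<in>UNIV. p (axis i 1))"
      unfolding scale using w nonneg by (intro sum_mono) (simp add: mult_left_le_one_le)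
    finally show "p w \<le> (\<Sum>i\<in>UNIV. p (axis i 1))" .
  qed
qed

theorem theorem1p4:
  fixes F G :: "real \<Rightarrow> real"
    and \<alpha>F \<alpha>G :: "real ^ 'd::finite \<Rightarrow> real"
  assumes "distribution_function F" and "distribution_function G"
    and "strictly_dominates F G"
    and "CARD('d) = 1 \<Longrightarrow> integrable (interval_measure F) (\<lambda>t. t)"
    and "CARD('d) = 1 \<Longrightarrow> integrable (interval_measure G) (\<lambda>t. t)"
    and "quenched_lyapunov_exponent F \<alpha>F" and "quenched_lyapunov_exponent G \<alpha>G"
  shows "\<exists>c>0. \<forall>x. x \<noteq> 0 \<longrightarrow> \<alpha>F x - \<alpha>G x \<ge> c * l1_norm x"
proof -
  obtain c where "c > 0" and c: "\<And>x :: int ^ 'd.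
    c * lattice_l1 x \<le> \<alpha>F (\<chi> i. real_of_int (x $ i)) - \<alpha>G (\<chi> i. real_of_int (x $ i))"
    using lattice_gap[OF assms(1-3,6,7)] by blast
  have semi: "seminorm \<alpha>F" "seminorm \<alpha>G"
    using assms(6,7) by (auto simp: quenched_lyapunov_exponent_def)
  have add: "\<alpha>F (x + y) \<le> \<alpha>F x + \<alpha>F y" "\<alpha>G (x + y) \<le> \<alpha>G x + \<alpha>G y"
    and scale: "\<alpha>F (r *\<^sub>R x) = \<bar>r\<bar> * \<alpha>F x" "\<alpha>G (r *\<^sub>R x) = \<bar>r\<bar> * \<alpha>G x" for x y r
    using semi by (auto simp: seminorm_def)
  obtain KF KG where K: "\<And>w. (\<And>i. \<bar>w $ i\<bar> \<le> 1) \<Longrightarrow> \<alpha>F w \<le> KF" "\<And>w. (\<And>i. \<bar>w $ i\<bar> \<le> 1) \<Longrightarrow> \<alpha>G w \<le> KG"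
    using seminorm_bounded_on_unit_cube[OF semi(1)] seminorm_bounded_on_unit_cube[OF semi(2)] by metis
  have "c * l1_norm x \<le> \<alpha>F x - \<alpha>G x" for x
  proof (rule ccontr)
    assume neg: "\<not> ?thesis"
    define r where "r = c * l1_norm x - (\<alpha>F x - \<alpha>G x)"
    have "r > 0" using neg by (simp add: r_def)
    \<comment> \<open>Round \<open>n x\<close> to a lattice point: the error is bounded, whereas a violation of the bound at \<open>x\<close>
      grows linearly in \<open>n\<close>.\<close>
    have "real n * r \<le> c * CARD('d) + KF + KG" for n
    proof -
      define y :: "int ^ 'd" where "y = (\<chi> i. \<lfloor>real n * x $ i\<rfloor>)"
      define y' :: "real ^ 'd" where "y' = (\<chi> i. real_of_int (y $ i))"
      have close: "\<bar>y' $ i - real n * x $ i\<bar> \<le> 1" for i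
        unfolding y'_def y_def vec_lambda_beta by linarith
      have "\<alpha>F y' \<le> \<alpha>F (real n *\<^sub>R x) + \<alpha>F (y' - real n *\<^sub>R x)"
        using add(1)[of "real n *\<^sub>R x" "y' - real n *\<^sub>R x"] by simp
      moreover have "\<alpha>F (y' - real n *\<^sub>R x) \<le> KF"
        using close by (intro K) simp
      moreover have "\<alpha>G (real n *\<^sub>R x) \<le> \<alpha>G y' + \<alpha>G (real n *\<^sub>R x - y')"
        using add(2)[of y' "real n *\<^sub>R x - y'"] by simp
      moreover have "\<alpha>G (real n *\<^sub>R x - y') \<le> KG"
        using close by (intro K) (simp add: abs_minus_commute)
      moreover have "c * lattice_l1 y \<le> \<alpha>F y' - \<alpha>G y'"
        unfolding y'_def by (rule c)
      moreover have "c * (real n * l1_norm x - CARD('d)) \<le> c * lattice_l1 y"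
      proof (rule mult_left_mono)
        have "real n * l1_norm x - CARD('d) = (\<Sum>i\<in>UNIV. \<bar>real n * x $ i\<bar> - 1)"
          by (simp add: l1_norm_def sum_subtractf sum_distrib_left abs_mult)
        also have "\<dots> \<le> (\<Sum>i\<in>UNIV. \<bar>real_of_int (y $ i)\<bar>)"
          unfolding y_def vec_lambda_beta by (intro sum_mono) linarith
        finally show "real n * l1_norm x - CARD('d) \<le> lattice_l1 y"
          by (simp add: lattice_l1_def)
      qed (use \<open>c > 0\<close> in simp)
      ultimately have "c * (real n * l1_norm x - CARD('d)) \<le> real n * \<alpha>F x - real n * \<alpha>G x + KF + KG"
        unfolding scale by simp
      then show ?thesis by (simp add: r_def algebra_simps)
    qed
    moreover obtain n where "c * CARD('d) + KF + KG < real n * r"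
      using reals_Archimedean3[OF \<open>r > 0\<close>] by blast
    ultimately show False by (simp add: not_le[symmetric])
  qed
  then show ?thesis using \<open>c > 0\<close> by blast
qed

end
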